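(* Let $M$ be a compact connected complex manifold of complex dimension $n\ge 2$, let $\omega,\chi$ be Hermitian metrics on $M$, let $F\in C^\infty(M,\mathbb R)$ and $\lambda\in\mathbb R$. If $\underline\varphi\in\mathcal H_\chi$ and $\mathcal Q_F(\underline\varphi)\ge\lambda$ on $M$, then $$n\chi_{\underline\varphi}^{\,n-1}>(n-1)e^{\lambda-F}\,\chi_{\underline\varphi}^{\,n-2}\wedge\omega\quad\text{on }M.$$ In particular, $[\chi]\in\mathcal C_1(F-\lambda)$.
   Context: Hermitian metrics are identified with their positive real $(1,1)$-forms; no closedness is assumed. $\mathcal H_\chi=\{\varphi\in C^\infty(M,\mathbb R):\chi_\varphi:=\chi+\sqrt{-1}\,\partial\bar\partial\varphi>0\}$. For $\varphi\in\mathcal H_\chi$, $$\mathcal Q_F(\varphi)=\log\frac{\chi_\varphi^n}{\omega\wedge\chi_\varphi^{n-1}}+F=\log n-\log\operatorname{tr}_{\chi_\varphi}\omega+F.$$ Strict inequality between real $(n-1,n-1)$-forms means that the difference is a strictly positive $(n-1,n-1)$-form. Cone condition: $[\chi]=\{\chi+\sqrt{-1}\,\partial\bar\partial f: f\in C^\infty(M,\mathbb R)\}$; for $H\in C^\infty(M,\mathbb R)$ one writes $[\chi]\in\mathcal C_1(H)$ if there exists $\widehat\chi\in[\chi]$ with $\widehat\chi>0$ such that $n\widehat\chi^{\,n-1}>(n-1)e^{-H}\,\widehat\chi^{\,n-2}\wedge\omega$ on $M$. *)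

theory Defs
  imports "HOL-Analysis.Analysis"
begin

section \<open>Complex manifolds\<close>

text \<open>
  A chart is a pair \<open>(U, c)\<close> of an open set and a coordinate map, of which only the restriction
  to \<open>U\<close> matters. The complex dimension is \<open>CARD('n)\<close>.
\<close>

type_synonym ('a, 'n) chart = "'a set \<times> ('a \<Rightarrow> (complex, 'n) vec)"

definition is_chart :: "'a topology \<Rightarrow> ('a, 'n::finite) chart \<Rightarrow> bool" where
  "is_chart X = (\<lambda>(U, c). openin X U \<and> open (c ` U) \<and>
     homeomorphic_map (subtopology X U) (top_of_set (c ` U)) c)"

definition chart_inv :: "('a, 'n::finite) chart \<Rightarrow> complex ^ 'n \<Rightarrow> 'a" where
  "chart_inv = (\<lambda>(U, c). inv_into U c)"

text \<open>Holomorphic maps between open subsets of \<open>\<complex>\<^sup>n\<close>: complex differentiable at every point.\<close>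

definition holomorphic_map_on :: "(complex ^ 'n::finite) set \<Rightarrow> (complex ^ 'n \<Rightarrow> complex ^ 'n) \<Rightarrow> bool" where
  "holomorphic_map_on S f \<longleftrightarrow>
     (\<forall>z\<in>S. \<exists>L. (f has_derivative L) (at z) \<and> Vector_Spaces.linear (*s) (*s) L)"

definition complex_manifold :: "'a topology \<Rightarrow> ('a, 'n::finite) chart set \<Rightarrow> bool" where
  "complex_manifold X A \<longleftrightarrow>
     Hausdorff_space X \<and> second_countable X \<and>
     (\<forall>C\<in>A. is_chart X C) \<and> (\<Union>C\<in>A. fst C) = topspace X \<and>
     (\<forall>C\<in>A. \<forall>D\<in>A. holomorphic_map_on (snd C ` (fst C \<inter> fst D)) (snd D \<circ> chart_inv C))"

text \<open>
  The tangent space at \<open>p\<close> is identified with \<open>\<complex>\<^sup>n\<close> by means of one chosen chart around \<open>p\<close>. All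
  pointwise notions below are invariant under complex linear isomorphisms, hence do not depend
  on this choice.
\<close>

definition chart_at :: "('a, 'n::finite) chart set \<Rightarrow> 'a \<Rightarrow> ('a, 'n) chart" where
  "chart_at A p = (SOME C. C \<in> A \<and> p \<in> fst C)"

text \<open>\<open>C\<^sup>k\<close> and smooth maps on an open set of a finite-dimensional space.\<close>

primrec Ck_on :: "nat \<Rightarrow> ('v::euclidean_space) set \<Rightarrow> ('v \<Rightarrow> 'b::real_normed_vector) \<Rightarrow> bool" where
  "Ck_on 0 S f \<longleftrightarrow> continuous_on S f"
| "Ck_on (Suc k) S f \<longleftrightarrow> (\<forall>x\<in>S. f differentiable (at x)) \<and>
     (\<forall>v. Ck_on k S (\<lambda>x. frechet_derivative f (at x) v))"

definition smooth_on :: "('v::euclidean_space) set \<Rightarrow> ('v \<Rightarrow> 'b::real_normed_vector) \<Rightarrow> bool" where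
  "smooth_on S f \<longleftrightarrow> (\<forall>k. Ck_on k S f)"

definition smooth_fun :: "('a, 'n::finite) chart set \<Rightarrow> ('a \<Rightarrow> real) \<Rightarrow> bool" where
  "smooth_fun A f \<longleftrightarrow> (\<forall>C\<in>A. smooth_on (snd C ` fst C) (f \<circ> chart_inv C))"

section \<open>Exterior algebra of a complex vector space\<close>

text \<open>
  A real form of degree \<open>k\<close> takes a sequence of vectors, of which only the first \<open>k\<close> are used.
\<close>

type_synonym 'n form = "(nat \<Rightarrow> (complex, 'n) vec) \<Rightarrow> real"

definition alternating_form :: "nat \<Rightarrow> 'n::finite form \<Rightarrow> bool" where
  "alternating_form k \<alpha> \<longleftrightarrow>
     (\<forall>v w. (\<forall>i<k. v i = w i) \<longrightarrow> \<alpha> v = \<alpha> w) \<and>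
     (\<forall>v. \<forall>i<k. linear (\<lambda>x. \<alpha> (v(i := x)))) \<and>
     (\<forall>v. \<forall>i<k. \<forall>j<k. i \<noteq> j \<and> v i = v j \<longrightarrow> \<alpha> v = 0)"

text \<open>
  Real \<open>(p,p)\<close>-forms: the unit scalar \<open>c\<close> multiplies the component of type \<open>(r,s)\<close> by
  \<open>c ^ r * cnj c ^ s\<close>, so for degree \<open>2p\<close> invariance leaves exactly the type \<open>(p,p)\<close>.
\<close>

definition real_pp_form :: "nat \<Rightarrow> 'n::finite form \<Rightarrow> bool" where
  "real_pp_form p \<alpha> \<longleftrightarrow> alternating_form (2 * p) \<alpha> \<and>
     (\<forall>c v. cmod c = 1 \<longrightarrow> \<alpha> (\<lambda>i. c *s v i) = \<alpha> v)"

definition wedge :: "nat \<Rightarrow> nat \<Rightarrow> 'n::finite form \<Rightarrow> 'n form \<Rightarrow> 'n form" where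
  "wedge k l \<alpha> \<beta> = (\<lambda>v.
     (\<Sum>\<sigma> | \<sigma> permutes {..<k + l}.
        of_int (sign \<sigma>) * \<alpha> (\<lambda>i. v (\<sigma> i)) * \<beta> (\<lambda>i. v (\<sigma> (k + i)))) / (fact k * fact l))"

text \<open>Exterior powers of a form of degree 2.\<close>

primrec wedge_pow :: "'n::finite form \<Rightarrow> nat \<Rightarrow> 'n form" where
  "wedge_pow \<alpha> 0 = (\<lambda>v. 1)"
| "wedge_pow \<alpha> (Suc m) = wedge (2 * m) 2 (wedge_pow \<alpha> m) \<alpha>"

text \<open>
  For \<open>\<alpha> = \<i> \<Sum> h\<^sub>j\<^sub>k dz\<^sub>j \<and> d\<zbar>\<^sub>k\<close> one has \<open>\<alpha> (u, \<i> u) = 2 \<Sum> h\<^sub>j\<^sub>k u\<^sub>j cnj u\<^sub>k\<close>, so the following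
  is positive definiteness of \<open>h\<close>.
\<close>

definition positive_11 :: "'n::finite form \<Rightarrow> bool" where
  "positive_11 \<alpha> \<longleftrightarrow> real_pp_form 1 \<alpha> \<and>
     (\<forall>u. u \<noteq> 0 \<longrightarrow> \<alpha> (\<lambda>i. if i = 0 then u else \<i> *s u) > 0)"

text \<open>
  Positivity of a form of degree \<open>2n\<close> for the orientation given by the complex structure, in
  which \<open>b\<^sub>0, \<i> b\<^sub>0, b\<^sub>1, \<i> b\<^sub>1, \<dots>\<close> is an oriented real basis for every complex basis \<open>b\<close>.
\<close>

definition positive_top :: "'n::finite form \<Rightarrow> bool" where
  "positive_top \<tau> \<longleftrightarrow>
     (\<forall>b :: nat \<Rightarrow> complex ^ 'n.
        inj_on b {..<CARD('n)} \<and> vec.independent (b ` {..<CARD('n)}) \<longrightarrow>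
        \<tau> (\<lambda>i. if even i then b (i div 2) else \<i> *s b (i div 2)) > 0)"

text \<open>The real \<open>(1,1)\<close>-form \<open>\<i> \<xi> \<and> cnj \<xi>\<close> of a \<open>(1,0)\<close>-covector \<open>\<xi>\<close>.\<close>

definition i_wedge_cnj :: "(complex ^ 'n::finite \<Rightarrow> complex) \<Rightarrow> 'n form" where
  "i_wedge_cnj \<xi> = (\<lambda>v. Re (\<i> * (\<xi> (v 0) * cnj (\<xi> (v 1)) - \<xi> (v 1) * cnj (\<xi> (v 0)))))"

definition strictly_positive_codeg1 :: "'n::finite form \<Rightarrow> bool" where
  "strictly_positive_codeg1 \<Theta> \<longleftrightarrow> real_pp_form (CARD('n) - 1) \<Theta> \<and>
     (\<forall>\<xi>. Vector_Spaces.linear (*s) (*) \<xi> \<and> \<xi> \<noteq> (\<lambda>_. 0) \<longrightarrow>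
        positive_top (wedge (2 * (CARD('n) - 1)) 2 \<Theta> (i_wedge_cnj \<xi>)))"

definition codeg1_less :: "'n::finite form \<Rightarrow> 'n form \<Rightarrow> bool" where
  "codeg1_less \<Phi> \<Psi> \<longleftrightarrow> strictly_positive_codeg1 (\<lambda>v. \<Psi> v - \<Phi> v)"

text \<open>
  The quotient of two forms of top degree, the second one nonzero.
\<close>

definition top_quotient :: "'n::finite form \<Rightarrow> 'n form \<Rightarrow> real" where
  "top_quotient \<alpha> \<beta> = (THE r. \<alpha> = (\<lambda>v. r * \<beta> v))"

section \<open>Forms on the manifold\<close>

type_synonym ('a, 'n) form_field = "'a \<Rightarrow> (nat \<Rightarrow> (complex, 'n) vec) \<Rightarrow> real"

text \<open>
  The expression in the chart \<open>C\<close> of a field of forms: the differential of the coordinate change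
  from \<open>C\<close> to the chart chosen at the point \<open>p\<close> takes a vector with components in \<open>C\<close> to its
  components in the identification of the tangent space at \<open>p\<close> with \<open>\<complex>\<^sup>n\<close>.
\<close>

definition local_expr ::
  "('a, 'n::finite) chart set \<Rightarrow> ('a, 'n) chart \<Rightarrow> ('a, 'n) form_field \<Rightarrow> complex ^ 'n \<Rightarrow> 'n form" where
  "local_expr A C \<alpha> z v =
     (let p = chart_inv C z
      in \<alpha> p (\<lambda>i. frechet_derivative (snd (chart_at A p) \<circ> chart_inv C) (at z) (v i)))"

definition smooth_form :: "('a, 'n::finite) chart set \<Rightarrow> ('a, 'n) form_field \<Rightarrow> bool" where
  "smooth_form A \<alpha> \<longleftrightarrow>
     (\<forall>C\<in>A. \<forall>v. smooth_on (snd C ` fst C) (\<lambda>z. local_expr A C \<alpha> z v))"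

definition hermitian_metric ::
  "'a topology \<Rightarrow> ('a, 'n::finite) chart set \<Rightarrow> ('a, 'n) form_field \<Rightarrow> bool" where
  "hermitian_metric X A \<omega> \<longleftrightarrow> smooth_form A \<omega> \<and> (\<forall>p\<in>topspace X. positive_11 (\<omega> p))"

definition d_dz :: "'n::finite \<Rightarrow> (complex ^ 'n \<Rightarrow> complex) \<Rightarrow> complex ^ 'n \<Rightarrow> complex" where
  "d_dz j h z = (frechet_derivative h (at z) (axis j 1) - \<i> * frechet_derivative h (at z) (axis j \<i>)) / 2"

definition d_dzbar :: "'n::finite \<Rightarrow> (complex ^ 'n \<Rightarrow> complex) \<Rightarrow> complex ^ 'n \<Rightarrow> complex" where
  "d_dzbar j h z = (frechet_derivative h (at z) (axis j 1) + \<i> * frechet_derivative h (at z) (axis j \<i>)) / 2"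

text \<open>
  The form \<open>\<i> \<Sum> (\<partial>\<^sup>2 g / \<partial>z\<^sub>j \<partial>\<zbar>\<^sub>k) dz\<^sub>j \<and> d\<zbar>\<^sub>k\<close> of a real function \<open>g\<close>. It is real because the
  coefficient matrix is Hermitian; \<open>Re\<close> only converts the type.
\<close>

definition i_ddbar_local :: "(complex ^ 'n::finite \<Rightarrow> real) \<Rightarrow> complex ^ 'n \<Rightarrow> 'n form" where
  "i_ddbar_local g z = (\<lambda>v. Re (\<i> *
     (\<Sum>j\<in>UNIV. \<Sum>k\<in>UNIV. d_dz j (d_dzbar k (\<lambda>w. complex_of_real (g w))) z *
        (v 0 $ j * cnj (v 1 $ k) - v 1 $ j * cnj (v 0 $ k)))))"

definition i_ddbar :: "('a, 'n::finite) chart set \<Rightarrow> ('a \<Rightarrow> real) \<Rightarrow> ('a, 'n) form_field" where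
  "i_ddbar A f p =
     i_ddbar_local (f \<circ> chart_inv (chart_at A p)) (snd (chart_at A p) p)"

definition deform ::
  "('a, 'n::finite) chart set \<Rightarrow> ('a, 'n) form_field \<Rightarrow> ('a \<Rightarrow> real) \<Rightarrow> ('a, 'n) form_field" where
  "deform A chi f = (\<lambda>p v. chi p v + i_ddbar A f p v)"

section \<open>Potentials, the operator \<open>Q\<close> and the cone condition\<close>

definition potentials ::
  "'a topology \<Rightarrow> ('a, 'n::finite) chart set \<Rightarrow> ('a, 'n) form_field \<Rightarrow> ('a \<Rightarrow> real) set" where
  "potentials X A chi =
     {\<phi>. smooth_fun A \<phi> \<and> (\<forall>p\<in>topspace X. positive_11 (deform A chi \<phi> p))}"

definition Q_op ::
  "('a, 'n::finite) chart set \<Rightarrow> ('a, 'n) form_field \<Rightarrow> ('a, 'n) form_field \<Rightarrow>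
   ('a \<Rightarrow> real) \<Rightarrow> ('a \<Rightarrow> real) \<Rightarrow> 'a \<Rightarrow> real" where
  "Q_op A \<omega> chi F \<phi> p =
     ln (top_quotient
           (wedge_pow (deform A chi \<phi> p) CARD('n))
           (wedge 2 (2 * (CARD('n) - 1)) (\<omega> p) (wedge_pow (deform A chi \<phi> p) (CARD('n) - 1))))
     + F p"

text \<open>
  The inequality \<open>n \<eta>\<^sup>n\<^sup>-\<^sup>1 > (n - 1) e\<^sup>-\<^sup>H \<eta>\<^sup>n\<^sup>-\<^sup>2 \<and> \<omega>\<close> of \<open>(n-1,n-1)\<close>-forms on the manifold.
\<close>

definition cone_inequality ::
  "'a topology \<Rightarrow> ('a, 'n::finite) form_field \<Rightarrow> ('a \<Rightarrow> real) \<Rightarrow> ('a, 'n) form_field \<Rightarrow> bool" where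
  "cone_inequality X \<omega> H \<eta> \<longleftrightarrow>
     (\<forall>p\<in>topspace X. codeg1_less
        (\<lambda>v. real (CARD('n) - 1) * exp (- H p) *
              wedge (2 * (CARD('n) - 2)) 2 (wedge_pow (\<eta> p) (CARD('n) - 2)) (\<omega> p) v)
        (\<lambda>v. real CARD('n) * wedge_pow (\<eta> p) (CARD('n) - 1) v))"

definition ddbar_class ::
  "('a, 'n::finite) chart set \<Rightarrow> ('a, 'n) form_field \<Rightarrow> ('a, 'n) form_field set" where
  "ddbar_class A chi = {deform A chi f | f. smooth_fun A f}"

definition cone_C1 ::
  "'a topology \<Rightarrow> ('a, 'n::finite) form_field \<Rightarrow> ('a \<Rightarrow> real) \<Rightarrow> ('a, 'n) form_field set set" where
  "cone_C1 X \<omega> H =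
     {K. \<exists>\<eta>\<in>K. (\<forall>p\<in>topspace X. positive_11 (\<eta> p)) \<and> cone_inequality X \<omega> H \<eta>}"

end

theory Submission
  imports Defs
begin

text \<open>
  At a point, write \<open>\<eta>\<close> for the deformed metric and \<open>r = e\<^sup>\<lambda>\<^sup>-\<^sup>F\<close>. Given a covector \<open>\<xi> \<noteq> 0\<close>, choose an
  \<open>\<eta>\<close>-unitary frame \<open>c\<close> all of whose vectors but the last lie in the kernel of \<open>\<xi>\<close>. Then \<open>\<eta>\<close> and
  \<open>\<i> \<xi> \<and> cnj \<xi>\<close> are diagonal, and in a top-degree product one non-diagonal factor contributes through
  its diagonal only, so \<open>\<omega>\<close> need not be diagonalised. With \<open>\<mu>\<^sub>j\<close> the diagonal of \<open>\<omega>\<close>, \<open>x\<^sub>j\<close> that of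
  \<open>\<i> \<xi> \<and> cnj \<xi>\<close> and \<open>T = \<Sum>\<mu>\<^sub>j\<close>, the hypothesis says \<open>r T \<le> n\<close>, and the form to be shown positive is a
  positive multiple of \<open>\<Sum> (n - r (T - \<mu>\<^sub>j)) x\<^sub>j \<ge> r \<Sum> \<mu>\<^sub>j x\<^sub>j > 0\<close>. Since top forms are proportional, it
  is then a positive multiple of \<open>\<eta>\<^sup>n\<close>, which is positive on every complex basis by Gram--Schmidt.
\<close>

section \<open>Alternating forms\<close>

text \<open>The covector \<xi> is arbitrary, and in general \<eta>, \<omega> and its rank-one form
  cannot all be diagonal in one frame. The rank-one form is the one to diagonalise along with
  \<eta>: being null on the kernel of \<xi>, it has no off-diagonal entries as soon as only one
  frame vector leaves that kernel.

  The computational obstacle is that forms are functions of real vectors and \<open>wedge\<close>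
  sums over permutations of all \<open>2 * n\<close> slots. On a frame, slots \<open>2 * j\<close>
  and \<open>2 * j + 1\<close> hold \<open>c j\<close> and \<open>\<i> *s c j\<close>; treating them
  as one block reduces the \<open>fact (2 * n)\<close> terms to a sum over permutations of
  \<open>n\<close> indices, a permanent of diagonal entries. The constant in front is the same for
  every top form evaluated, so it cancels in quotients and only its sign matters in inequalities. In
  particular \<open>top_quotient\<close> becomes \<open>n / T\<close>, which is how the bound on
  \<open>Q_op\<close> turns into a bound on the trace.\<close>

lemma linear_times_left: "linear f \<Longrightarrow> linear (\<lambda>x. c * f x)" for f :: "'v::real_vector \<Rightarrow> real"
  using linear_compose_scale_right[of f c] by simp

lemma linear_times_right: "linear f \<Longrightarrow> linear (\<lambda>x. f x * c)" for f :: "'v::real_vector \<Rightarrow> real"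
  using linear_times_left[of f c] by (simp add: mult.commute)

lemma alternating_formD:
  assumes "alternating_form k \<alpha>"
  shows alternating_form_cong: "(\<And>i. i < k \<Longrightarrow> v i = w i) \<Longrightarrow> \<alpha> v = \<alpha> w"
    and alternating_form_linear: "i < k \<Longrightarrow> linear (\<lambda>x. \<alpha> (v(i := x)))"
    and alternating_form_eq: "i < k \<Longrightarrow> j < k \<Longrightarrow> i \<noteq> j \<Longrightarrow> v i = v j \<Longrightarrow> \<alpha> v = 0"
proof -
  show "\<alpha> v = \<alpha> w" if "\<And>i. i < k \<Longrightarrow> v i = w i"
    using assms that unfolding alternating_form_def by simp
  show "linear (\<lambda>x. \<alpha> (v(i := x)))" if "i < k"
    using assms that unfolding alternating_form_def by simp
  show "\<alpha> v = 0" if "i < k" "j < k" "i \<noteq> j" "v i = v j"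
    using assms that unfolding alternating_form_def by metis
qed

lemma alternating_form_add:
  "alternating_form k \<alpha> \<Longrightarrow> i < k \<Longrightarrow> \<alpha> (v(i := x + y)) = \<alpha> (v(i := x)) + \<alpha> (v(i := y))"
  using linear_add[OF alternating_form_linear] .

lemma alternating_form_span_eq_0:
  assumes \<alpha>: "alternating_form k \<alpha>" and j: "j < k" and x: "x \<in> span (v ` ({..<k} - {j}))"
  shows "\<alpha> (v(j := x)) = 0"
proof -
  have "\<alpha> (v(j := y)) = 0" if y: "y \<in> v ` ({..<k} - {j})" for y
  proof -
    obtain i where i: "i < k" "i \<noteq> j" "y = v i" using y by auto
    show ?thesis
      by (rule alternating_form_eq[OF \<alpha> i(1) j i(2)]) (use i in auto)
  qed
  then show ?thesis
    by (rule linear_eq_0_on_span[OF alternating_form_linear[OF \<alpha> j] _ x])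
qed

lemma alternating_form_add_span:
  assumes "alternating_form k \<alpha>" "j < k" "x \<in> span (v ` ({..<k} - {j}))"
  shows "\<alpha> (v(j := v j + x)) = \<alpha> v"
  unfolding alternating_form_add[OF assms(1,2)] alternating_form_span_eq_0[OF assms] by simp

text \<open>\<open>alternating_form\<close> demands vanishing on repeated arguments; the sign rule
  follows by polarisation, placing \<open>v i + v j\<close> in both slots.\<close>

lemma alternating_form_transpose:
  assumes \<alpha>: "alternating_form k \<alpha>" and ij: "i < k" "j < k" "i \<noteq> j"
  shows "\<alpha> (v \<circ> Transposition.transpose i j) = - \<alpha> v"
proof -
  have D: "\<alpha> (u(i := x, j := x)) = 0" for u x
    by (rule alternating_form_eq[OF \<alpha> ij]) (use ij in auto)
  let ?a = "v i" and ?b = "v j"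
  have "0 = \<alpha> (v(i := ?a + ?b, j := ?a + ?b))" using D by simp
  also have "\<dots> = \<alpha> (v(i := ?a + ?b, j := ?a)) + \<alpha> (v(i := ?a + ?b, j := ?b))"
    by (rule alternating_form_add[OF \<alpha> ij(2)])
  also have "\<alpha> (v(i := ?a + ?b, j := ?a)) = \<alpha> (v(i := ?b, j := ?a))"
    using alternating_form_add[OF \<alpha> ij(1), of "v(j := ?a)" ?a ?b] D[of v ?a] ij
    by (simp add: fun_upd_twist del: fun_upd_triv)
  also have "\<alpha> (v(i := ?a + ?b, j := ?b)) = \<alpha> (v(i := ?a, j := ?b))"
    using alternating_form_add[OF \<alpha> ij(1), of "v(j := ?b)" ?a ?b] D[of v ?b] ij
    by (simp add: fun_upd_twist del: fun_upd_triv)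
  also have "v(i := ?b, j := ?a) = v \<circ> Transposition.transpose i j"
    using ij by (auto simp: fun_eq_iff Transposition.transpose_def)
  finally have "\<alpha> (v \<circ> Transposition.transpose i j) + \<alpha> v = 0"
    unfolding fun_upd_triv by (rule sym)
  then show ?thesis by linarith
qed

lemma alternating_form_permute:
  assumes \<alpha>: "alternating_form k \<alpha>" and "p permutes {..<k}"
  shows "\<alpha> (v \<circ> p) = of_int (sign p) * \<alpha> v"
  using assms(2) finite_lessThan
proof (induction p arbitrary: v rule: permutes_induct)
  case id
  then show ?case by (simp add: sign_id)
next
  case (swap a b p)
  have *: "\<alpha> (v \<circ> (Transposition.transpose a b \<circ> p)) = of_int (sign p) * \<alpha> (v \<circ> Transposition.transpose a b)"
    using swap.IH[of "v \<circ> Transposition.transpose a b"] by (simp only: o_assoc)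
  have s: "sign (Transposition.transpose a b \<circ> p) = sign (Transposition.transpose a b) * sign p"
    using swap by (intro sign_compose permutation_swap_id permutes_imp_permutation[of "{..<k}" p]) auto
  show ?case
    using alternating_form_transpose[OF \<alpha>, of a b v] swap(1-3)
    unfolding * s by (simp add: sign_swap_id)
qed

section \<open>Proportionality of forms of top degree\<close>

text \<open>Expanding every argument over the spanning list leaves values on lists drawn from
  \<open>w\<close>: a repeated entry gives 0, and otherwise the list is a permutation of
  \<open>w\<close> and gives \<open>\<alpha> w\<close> up to sign.\<close>

lemma alternating_form_zero_if_spanning:
  assumes \<alpha>: "alternating_form k \<alpha>" and sp: "span (w ` {..<k}) = UNIV" and z: "\<alpha> w = 0"
  shows "\<alpha> v = 0"
proof -
  have perm: "\<alpha> (\<lambda>i. w (f i)) = 0" if f: "\<forall>i<k. f i < k" for f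
  proof (cases "inj_on f {..<k}")
    case True
    define p where "p = (\<lambda>i. if i < k then f i else i)"
    have "p permutes {..<k}"
      by (rule inj_imp_permutes) (use f True in \<open>auto simp: p_def inj_on_def\<close>)
    then have "\<alpha> (w \<circ> p) = 0" using alternating_form_permute[OF \<alpha>, of p w] z by simp
    then show ?thesis
      using alternating_form_cong[OF \<alpha>, of "\<lambda>i. w (f i)" "w \<circ> p"] by (simp add: p_def)
  next
    case False
    then obtain i j where "i < k" "j < k" "i \<noteq> j" "f i = f j" unfolding inj_on_def by auto
    then show ?thesis using alternating_form_eq[OF \<alpha>, of i j "\<lambda>i. w (f i)"] by simp
  qed
  \<comment> \<open>Slots from \<open>m\<close> on already hold entries of \<open>w\<close>; the
    induction frees one more slot at a time by linearity.\<close>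
  have "\<alpha> v = 0" if "m \<le> k" "\<And>i. m \<le> i \<Longrightarrow> i < k \<Longrightarrow> v i \<in> w ` {..<k}" for m v
    using that
  proof (induction m arbitrary: v)
    case 0
    then have "\<forall>i<k. \<exists>l<k. v i = w l" by auto
    then obtain f where "\<forall>i<k. f i < k \<and> v i = w (f i)" by metis
    then show ?case
      using perm[of f] alternating_form_cong[OF \<alpha>, of v "\<lambda>i. w (f i)"] by simp
  next
    case (Suc m)
    have "\<alpha> (v(m := x)) = 0" if "x \<in> w ` {..<k}" for x
    proof (rule Suc.IH)
      show "(v(m := x)) i \<in> w ` {..<k}" if "m \<le> i" "i < k" for i
        using Suc.prems(2)[of i] that \<open>x \<in> w ` {..<k}\<close> by (cases "i = m") simp_all
    qed (use Suc.prems(1) in simp)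
    note on_w = this
    have m: "m < k" using Suc.prems(1) by simp
    have "\<alpha> (v(m := v m)) = 0"
    proof (rule linear_eq_0_on_span[OF alternating_form_linear[OF \<alpha> m]])
      show "v m \<in> span (w ` {..<k})" unfolding sp by (rule UNIV_I)
    qed (rule on_w)
    then show ?case by (simp only: fun_upd_triv)
  qed
  note main = this
  show ?thesis
  proof (rule main[of k])
    show "v i \<in> w ` {..<k}" if "k \<le> i" "i < k" for i using that by linarith
  qed (rule order_refl)
qed

text \<open>A linear relation would put one argument into the span of the others and force the value
  0. So the arguments are independent over the reals, and there are as many of them as the real
  dimension.\<close>

lemma alternating_form_nonzero_imp_spanning:
  fixes \<beta> :: "'n::finite form"
  assumes \<beta>: "alternating_form (2 * CARD('n)) \<beta>" and nz: "\<beta> w \<noteq> 0"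
  shows "span (w ` {..<2 * CARD('n)}) = UNIV"
proof -
  let ?N = "2 * CARD('n)"
  have inj: "inj_on w {..<?N}"
    unfolding inj_on_def using alternating_form_eq[OF \<beta>] nz by (metis lessThan_iff)
  have "independent (w ` {..<?N})"
  proof (rule ccontr)
    assume "\<not> ?thesis"
    then obtain j where j: "j < ?N" "w j \<in> span (w ` {..<?N} - {w j})"
      unfolding dependent_def by auto
    \<comment> \<open>Injectivity makes removing the vector \<open>w j\<close> the same as removing
      the slot \<open>j\<close>.\<close>
    moreover have "w ` {..<?N} - {w j} = w ` ({..<?N} - {j})"
      using inj j by (auto simp: inj_on_def)
    ultimately have "\<beta> (w(j := w j)) = 0"
      by (intro alternating_form_span_eq_0[OF \<beta>]) auto
    then show False using nz by simp
  qed
  then have "UNIV \<subseteq> span (w ` {..<?N})"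
    by (intro card_ge_dim_independent) (simp_all add: card_image[OF inj])
  then show ?thesis by auto
qed

lemma alternating_form_combination:
  assumes \<alpha>: "alternating_form k \<alpha>" and \<beta>: "alternating_form k \<beta>"
  shows "alternating_form k (\<lambda>v. a * \<alpha> v - b * \<beta> v)"
  unfolding alternating_form_def
proof (intro conjI allI impI)
  fix v u :: "nat \<Rightarrow> complex ^ 'a" assume "\<forall>i<k. v i = u i"
  then show "a * \<alpha> v - b * \<beta> v = a * \<alpha> u - b * \<beta> u"
    using alternating_form_cong[OF \<alpha>, of v u] alternating_form_cong[OF \<beta>, of v u] by simp
next
  fix v :: "nat \<Rightarrow> complex ^ 'a" and i assume i: "i < k"
  show "linear (\<lambda>x. a * \<alpha> (v(i := x)) - b * \<beta> (v(i := x)))"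
    by (rule linear_compose_sub[OF linear_times_left[OF alternating_form_linear[OF \<alpha> i]]
          linear_times_left[OF alternating_form_linear[OF \<beta> i]]])
next
  fix v :: "nat \<Rightarrow> complex ^ 'a" and i j assume "i < k" "j < k" "i \<noteq> j \<and> v i = v j"
  then show "a * \<alpha> v - b * \<beta> v = 0"
    using alternating_form_eq[OF \<alpha>, of i j v] alternating_form_eq[OF \<beta>, of i j v] by simp
qed

text \<open>The difference of the two sides is alternating and vanishes on \<open>w\<close>, whose
  entries span because \<open>\<beta> w \<noteq> 0\<close>.\<close>

lemma top_form_unique:
  fixes \<alpha> \<beta> :: "'n::finite form"
  assumes \<alpha>: "alternating_form (2 * CARD('n)) \<alpha>" and \<beta>: "alternating_form (2 * CARD('n)) \<beta>"
    and nz: "\<beta> w \<noteq> 0"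
  shows "\<alpha> v = \<alpha> w / \<beta> w * \<beta> v"
proof -
  define \<gamma> where "\<gamma> = (\<lambda>v. 1 * \<alpha> v - \<alpha> w / \<beta> w * \<beta> v)"
  have "alternating_form (2 * CARD('n)) \<gamma>"
    unfolding \<gamma>_def by (rule alternating_form_combination[OF \<alpha> \<beta>])
  then have "\<gamma> v = 0"
    by (rule alternating_form_zero_if_spanning[OF _ alternating_form_nonzero_imp_spanning[OF \<beta> nz]])
      (use nz in \<open>simp add: \<gamma>_def\<close>)
  then show ?thesis by (simp add: \<gamma>_def)
qed

text \<open>Turns the definite description into a number that can be read off on any single
  frame.\<close>

lemma top_quotient_eq:
  fixes \<alpha> \<beta> :: "'n::finite form"
  assumes \<alpha>: "alternating_form (2 * CARD('n)) \<alpha>" and \<beta>: "alternating_form (2 * CARD('n)) \<beta>"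
    and nz: "\<beta> w \<noteq> 0"
  shows "top_quotient \<alpha> \<beta> = \<alpha> w / \<beta> w"
  unfolding top_quotient_def
proof (rule the_equality)
  show "\<alpha> = (\<lambda>v. \<alpha> w / \<beta> w * \<beta> v)" by (intro ext top_form_unique[OF assms])
  show "r = \<alpha> w / \<beta> w" if "\<alpha> = (\<lambda>v. r * \<beta> v)" for r
    using fun_cong[OF that, of w] nz by simp
qed

section \<open>Exterior products\<close>

lemma alternating_form_comp_permute_linear:
  assumes \<alpha>: "alternating_form k \<alpha>" and p: "inj p" and i: "i < k"
  shows "linear (\<lambda>x. \<alpha> (\<lambda>l. (v(p i := x)) (p l)))"
proof -
  have "(\<lambda>l. (v(p i := x)) (p l)) = (\<lambda>l. v (p l))(i := x)" for x
    using p by (auto simp: fun_eq_iff inj_def)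
  then show ?thesis by (simp only: alternating_form_linear[OF \<alpha> i])
qed

lemma alternating_form_wedge:
  assumes \<alpha>: "alternating_form k \<alpha>" and \<beta>: "alternating_form l \<beta>"
  shows "alternating_form (k + l) (wedge k l \<alpha> \<beta>)"
  unfolding alternating_form_def
proof (intro conjI allI impI)
  fix v w :: "nat \<Rightarrow> complex ^ 'a" assume vw: "\<forall>i<k + l. v i = w i"
  have *: "\<alpha> (\<lambda>i. v (\<sigma> i)) = \<alpha> (\<lambda>i. w (\<sigma> i)) \<and> \<beta> (\<lambda>i. v (\<sigma> (k + i))) = \<beta> (\<lambda>i. w (\<sigma> (k + i)))"
    if \<sigma>: "\<sigma> permutes {..<k + l}" for \<sigma>
  proof -
    have "v (\<sigma> i) = w (\<sigma> i)" if "i < k + l" for i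
      using permutes_in_image[OF \<sigma>, of i] that vw by simp
    then show ?thesis
      by (intro conjI alternating_form_cong[OF \<alpha>] alternating_form_cong[OF \<beta>]) auto
  qed
  show "wedge k l \<alpha> \<beta> v = wedge k l \<alpha> \<beta> w"
    unfolding wedge_def
  proof (intro arg_cong2[where f="(/)"] sum.cong refl)
    fix \<sigma> assume "\<sigma> \<in> {\<sigma>. \<sigma> permutes {..<k + l}}"
    then have "\<sigma> permutes {..<k + l}" by simp
    from *[OF this] show "of_int (sign \<sigma>) * \<alpha> (\<lambda>i. v (\<sigma> i)) * \<beta> (\<lambda>i. v (\<sigma> (k + i)))
        = of_int (sign \<sigma>) * \<alpha> (\<lambda>i. w (\<sigma> i)) * \<beta> (\<lambda>i. w (\<sigma> (k + i)))"
      by metis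
  qed
next
  fix v :: "nat \<Rightarrow> complex ^ 'a" and j assume j: "j < k + l"
  have *: "linear (\<lambda>x. of_int (sign \<sigma>) * \<alpha> (\<lambda>i. (v(j := x)) (\<sigma> i)) * \<beta> (\<lambda>i. (v(j := x)) (\<sigma> (k + i))))"
    if \<sigma>: "\<sigma> permutes {..<k + l}" for \<sigma>
  proof -
    have inj: "inj \<sigma>" using permutes_inj[OF \<sigma>] .
    \<comment> \<open>The position \<open>m\<close> that receives argument \<open>j\<close> belongs
      to exactly one of the two factors; the other factor is constant in \<open>x\<close>.\<close>
    obtain m where m: "\<sigma> m = j" using permutes_surj[OF \<sigma>] by (metis surjD)
    have mkl: "m < k + l" using permutes_in_image[OF \<sigma>, of m] m j by simp
    show ?thesis
    proof (cases "m < k")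
      case True
      have c: "\<beta> (\<lambda>i. (v(j := x)) (\<sigma> (k + i))) = \<beta> (\<lambda>i. v (\<sigma> (k + i)))" for x
        by (rule alternating_form_cong[OF \<beta>]) (use inj m True in \<open>auto simp: inj_eq\<close>)
      have "linear (\<lambda>x. \<alpha> (\<lambda>i. (v(j := x)) (\<sigma> i)))"
        using alternating_form_comp_permute_linear[OF \<alpha> inj True, of v] by (simp only: m)
      then show ?thesis unfolding c by (rule linear_times_right[OF linear_times_left])
    next
      case False
      have c: "\<alpha> (\<lambda>i. (v(j := x)) (\<sigma> i)) = \<alpha> (\<lambda>i. v (\<sigma> i))" for x
        by (rule alternating_form_cong[OF \<alpha>]) (use inj m False in \<open>auto simp: inj_eq\<close>)
      have mk: "m - k < l" and km: "\<sigma> (k + (m - k)) = j" using False m mkl by auto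
      have "inj (\<lambda>i. \<sigma> (k + i))" using inj by (intro injI) (simp add: inj_eq)
      then have "linear (\<lambda>x. \<beta> (\<lambda>i. (v(j := x)) (\<sigma> (k + i))))"
        using alternating_form_comp_permute_linear[OF \<beta> _ mk, of "\<lambda>i. \<sigma> (k + i)" v] by (simp only: km)
      then show ?thesis unfolding c by (rule linear_times_left)
    qed
  qed
  show "linear (\<lambda>x. wedge k l \<alpha> \<beta> (v(j := x)))"
    unfolding wedge_def divide_inverse
  proof (rule linear_times_right[OF linear_compose_sum], rule ballI)
    fix \<sigma> assume "\<sigma> \<in> {\<sigma>. \<sigma> permutes {..<k + l}}"
    then have "\<sigma> permutes {..<k + l}" by simp
    then show "linear (\<lambda>x. of_int (sign \<sigma>) * \<alpha> (\<lambda>i. (v(j := x)) (\<sigma> i)) * \<beta> (\<lambda>i. (v(j := x)) (\<sigma> (k + i))))"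
      by (rule *)
  qed
next
  fix v :: "nat \<Rightarrow> complex ^ 'a" and i j
  assume i: "i < k + l" and j: "j < k + l" and ij: "i \<noteq> j \<and> v i = v j"
  let ?t = "Transposition.transpose i j"
  let ?f = "\<lambda>\<sigma>. of_int (sign \<sigma>) * \<alpha> (\<lambda>i. v (\<sigma> i)) * \<beta> (\<lambda>i. v (\<sigma> (k + i)))"
  \<comment> \<open>Composing with this transposition preserves both factors, since
    \<open>v i = v j\<close>, and reverses the sign, so the sum equals its own negative.\<close>
  have t: "?t permutes {..<k + l}" using i j by (intro permutes_swap_id) auto
  have vt: "v (?t x) = v x" for x using ij by (auto simp: Transposition.transpose_def)
  have "sum ?f {\<sigma>. \<sigma> permutes {..<k + l}} = sum (\<lambda>\<sigma>. ?f (?t \<circ> \<sigma>)) {\<sigma>. \<sigma> permutes {..<k + l}}"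
    by (rule setum_permutations_compose_left[OF t])
  also have "\<dots> = sum (\<lambda>\<sigma>. - ?f \<sigma>) {\<sigma>. \<sigma> permutes {..<k + l}}"
  proof (rule sum.cong[OF refl])
    fix \<sigma> assume "\<sigma> \<in> {\<sigma>. \<sigma> permutes {..<k + l}}"
    then have "sign (?t \<circ> \<sigma>) = - sign \<sigma>"
      using ij by (subst sign_compose)
        (auto simp: permutation_swap_id sign_swap_id intro: permutes_imp_permutation[rotated])
    then show "?f (?t \<circ> \<sigma>) = - ?f \<sigma>" unfolding comp_apply[of ?t \<sigma>] vt by simp
  qed
  also have "\<dots> = - sum ?f {\<sigma>. \<sigma> permutes {..<k + l}}"
    by (rule sum_negf)
  finally have "sum ?f {\<sigma>. \<sigma> permutes {..<k + l}} = 0" by linarith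
  then show "wedge k l \<alpha> \<beta> v = 0"
    unfolding wedge_def by (rule trans[OF arg_cong[where f="\<lambda>x. x / _"] div_0])
qed

lemma real_pp_form_wedge:
  assumes "real_pp_form p \<alpha>" and "real_pp_form q \<beta>"
  shows "real_pp_form (p + q) (wedge (2 * p) (2 * q) \<alpha> \<beta>)"
proof -
  have "alternating_form (2 * (p + q)) (wedge (2 * p) (2 * q) \<alpha> \<beta>)"
    using alternating_form_wedge[of "2 * p" \<alpha> "2 * q" \<beta>] assms
    by (simp add: real_pp_form_def algebra_simps)
  then show ?thesis using assms by (simp add: real_pp_form_def wedge_def)
qed

lemma real_pp_form_wedge_pow: "real_pp_form 1 \<eta> \<Longrightarrow> real_pp_form m (wedge_pow \<eta> m)"
proof (induction m)
  case 0
  then show ?case by (auto simp: real_pp_form_def alternating_form_def)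
next
  case (Suc m)
  then show ?case using real_pp_form_wedge[of m "wedge_pow \<eta> m" 1 \<eta>] by simp
qed

lemma real_pp_form_combination:
  assumes \<alpha>: "real_pp_form p \<alpha>" and \<beta>: "real_pp_form p \<beta>"
  shows "real_pp_form p (\<lambda>v. a * \<alpha> v - b * \<beta> v)"
proof -
  have "alternating_form (2 * p) \<alpha>" "alternating_form (2 * p) \<beta>"
    using assms by (auto simp: real_pp_form_def)
  then show ?thesis
    using assms alternating_form_combination by (simp add: real_pp_form_def)
qed

lemma wedge_combination:
  "wedge k l (\<lambda>v. a * \<alpha> v - b * \<beta> v) \<gamma> v = a * wedge k l \<alpha> \<gamma> v - b * wedge k l \<beta> \<gamma> v"
  unfolding wedge_def
  by (simp add: sum_distrib_left sum_subtractf[symmetric] diff_divide_distrib[symmetric] algebra_simps)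

text \<open>The denominator in \<open>Q_op\<close> has \<omega> on the left, whereas products are
  built up below by appending factors on the right.\<close>

lemma wedge_2_commute:
  assumes \<alpha>: "alternating_form 2 \<alpha>" and \<beta>: "alternating_form k \<beta>"
  shows "wedge 2 k \<alpha> \<beta> = wedge k 2 \<beta> \<alpha>"
proof -
  define N where "N = k + 2"
  \<comment> \<open>The two factors are exchanged by \<open>r \<circ> r\<close>, which is even as a square.\<close>
  define r where "r = (\<lambda>i. if i < N - 1 then i + 1 else if i = N - 1 then 0 else i)"
  have r: "r permutes {..<N}"
    by (rule inj_imp_permutes) (auto simp: r_def N_def inj_on_def)
  have rr: "r \<circ> r permutes {..<N}" using permutes_compose[OF r r] .
  have sr: "sign (\<sigma> \<circ> (r \<circ> r)) = sign \<sigma>" if "\<sigma> permutes {..<N}" for \<sigma>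
    using that r rr
    by (simp add: sign_compose permutes_imp_permutation[of "{..<N}"] flip: mult.assoc)
  show ?thesis
  proof
    fix v :: "nat \<Rightarrow> complex ^ 'a"
    let ?f = "\<lambda>\<sigma>. of_int (sign \<sigma>) * \<beta> (\<lambda>i. v (\<sigma> i)) * \<alpha> (\<lambda>i. v (\<sigma> (k + i)))"
    have "sum ?f {\<sigma>. \<sigma> permutes {..<N}} = sum (\<lambda>\<sigma>. ?f (\<sigma> \<circ> (r \<circ> r))) {\<sigma>. \<sigma> permutes {..<N}}"
      by (rule sum_permutations_compose_right[OF rr])
    also have "\<dots> = (\<Sum>\<sigma> | \<sigma> permutes {..<N}.
        of_int (sign \<sigma>) * \<alpha> (\<lambda>i. v (\<sigma> i)) * \<beta> (\<lambda>i. v (\<sigma> (2 + i))))"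
    proof (rule sum.cong[OF refl])
      fix \<sigma> assume \<sigma>: "\<sigma> \<in> {\<sigma>. \<sigma> permutes {..<N}}"
      have "\<alpha> (\<lambda>i. v ((\<sigma> \<circ> (r \<circ> r)) (k + i))) = \<alpha> (\<lambda>i. v (\<sigma> i))"
        by (rule alternating_form_cong[OF \<alpha>]) (auto simp: r_def N_def less_2_cases_iff)
      moreover have "\<beta> (\<lambda>i. v ((\<sigma> \<circ> (r \<circ> r)) i)) = \<beta> (\<lambda>i. v (\<sigma> (2 + i)))"
        by (rule alternating_form_cong[OF \<beta>]) (auto simp: r_def N_def)
      ultimately show "?f (\<sigma> \<circ> (r \<circ> r)) = of_int (sign \<sigma>) * \<alpha> (\<lambda>i. v (\<sigma> i)) * \<beta> (\<lambda>i. v (\<sigma> (2 + i)))"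
        using sr \<sigma> by (simp add: mult_ac)
    qed
    finally show "wedge 2 k \<alpha> \<beta> v = wedge k 2 \<beta> \<alpha> v"
      unfolding wedge_def N_def by (simp add: add.commute mult.commute)
  qed
qed

text \<open>The exterior product of the 2-forms \<open>\<alpha> 0, \<dots>, \<alpha> (m - 1)\<close>, without the iterated normalisations.\<close>

definition mixed :: "nat \<Rightarrow> (nat \<Rightarrow> 'n::finite form) \<Rightarrow> 'n form" where
  "mixed m \<alpha> = (\<lambda>v. (\<Sum>\<sigma> | \<sigma> permutes {..<2 * m}.
     of_int (sign \<sigma>) * (\<Prod>i<m. \<alpha> i (\<lambda>l. v (\<sigma> (2 * i + l))))) / 2 ^ m)"

lemma mixed_cong: "(\<And>i. i < m \<Longrightarrow> \<alpha> i = \<beta> i) \<Longrightarrow> mixed m \<alpha> = mixed m \<beta>"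
  unfolding mixed_def by (intro ext arg_cong2[where f="(/)"] sum.cong arg_cong2[where f="(*)"] prod.cong) auto

text \<open>A permutation of the first \<open>2 * m\<close> slots can be absorbed into the outer
  one. The resulting multiplicity \<open>fact (2 * m)\<close> cancels the normalisation of
  \<open>wedge\<close>, whose \<open>fact 2\<close> supplies the last factor of
  \<open>2 ^ Suc m\<close>.\<close>

lemma wedge_mixed:
  fixes \<alpha> :: "nat \<Rightarrow> 'n::finite form"
  shows "wedge (2 * m) 2 (mixed m \<alpha>) (\<alpha> m) = mixed (Suc m) \<alpha>"
proof
  fix v :: "nat \<Rightarrow> complex ^ 'n"
  let ?S = "{\<sigma>. \<sigma> permutes {..<2 * m + 2}}" and ?T = "{\<sigma>. \<sigma> permutes {..<2 * m}}"
  define g where "g = (\<lambda>\<sigma>. of_int (sign \<sigma>) * (\<Prod>i<Suc m. \<alpha> i (\<lambda>l. v (\<sigma> (2 * i + l)))))"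
  have "(\<Sum>\<sigma>\<in>?S. of_int (sign \<sigma>) * mixed m \<alpha> (\<lambda>i. v (\<sigma> i)) * \<alpha> m (\<lambda>i. v (\<sigma> (2 * m + i))))
      = (\<Sum>\<sigma>\<in>?S. (\<Sum>\<tau>\<in>?T. g (\<sigma> \<circ> \<tau>)) / 2 ^ m)"
  proof (rule sum.cong[OF refl])
    fix \<sigma> assume \<sigma>: "\<sigma> \<in> ?S"
    have "g (\<sigma> \<circ> \<tau>) = of_int (sign \<sigma>) * of_int (sign \<tau>) *
        (\<Prod>i<m. \<alpha> i (\<lambda>l. v (\<sigma> (\<tau> (2 * i + l))))) * \<alpha> m (\<lambda>i. v (\<sigma> (2 * m + i)))"
      if \<tau>: "\<tau> \<in> ?T" for \<tau>
    proof -
      have "\<tau> (2 * m + l) = 2 * m + l" for l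
        using \<tau> by (intro permutes_not_in[of \<tau> "{..<2 * m}"]) auto
      moreover have "sign (\<sigma> \<circ> \<tau>) = sign \<sigma> * sign \<tau>"
        using \<sigma> \<tau> by (intro sign_compose) (auto intro: permutes_imp_permutation[rotated])
      ultimately show ?thesis by (simp add: g_def)
    qed
    then show "of_int (sign \<sigma>) * mixed m \<alpha> (\<lambda>i. v (\<sigma> i)) * \<alpha> m (\<lambda>i. v (\<sigma> (2 * m + i)))
        = (\<Sum>\<tau>\<in>?T. g (\<sigma> \<circ> \<tau>)) / 2 ^ m"
      by (simp add: mixed_def sum_distrib_left sum_distrib_right mult_ac)
  qed
  also have "\<dots> = (\<Sum>\<tau>\<in>?T. \<Sum>\<sigma>\<in>?S. g (\<sigma> \<circ> \<tau>)) / 2 ^ m"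
    by (subst sum.swap) (simp add: sum_divide_distrib)
  also have "\<dots> = (\<Sum>\<tau>\<in>?T. \<Sum>\<sigma>\<in>?S. g \<sigma>) / 2 ^ m"
  proof -
    have "(\<Sum>\<sigma>\<in>?S. g (\<sigma> \<circ> \<tau>)) = (\<Sum>\<sigma>\<in>?S. g \<sigma>)" if "\<tau> \<in> ?T" for \<tau>
    proof -
      have "\<tau> permutes {..<2 * m + 2}" using that by (auto intro: permutes_subset)
      then show ?thesis by (rule sum_permutations_compose_right[symmetric])
    qed
    then show ?thesis by simp
  qed
  also have "\<dots> = fact (2 * m) * (\<Sum>\<sigma>\<in>?S. g \<sigma>) / 2 ^ m"
    by (simp add: card_permutations[of "{..<2 * m}" "2 * m"])
  finally have "wedge (2 * m) 2 (mixed m \<alpha>) (\<alpha> m) v = (\<Sum>\<sigma>\<in>?S. g \<sigma>) / 2 ^ Suc m"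
    unfolding wedge_def by (simp add: divide_simps del: sum_divide_distrib)
  then show "wedge (2 * m) 2 (mixed m \<alpha>) (\<alpha> m) v = mixed (Suc m) \<alpha> v"
    by (simp only: mixed_def g_def mult_Suc_right add.commute[of 2])
qed

lemma wedge_pow_eq_mixed: "wedge_pow \<eta> m = mixed m (\<lambda>_. \<eta>)"
proof (induction m)
  case 0
  then show ?case by (simp add: mixed_def)
next
  case (Suc m)
  then show ?case using wedge_mixed[of m "\<lambda>_. \<eta>"] by simp
qed

section \<open>Permutations of blocks of size two\<close>

lemma block_cases:
  fixes x y i :: nat
  assumes "x \<noteq> y" "x div 2 = i" "y div 2 = i"
  shows "x = 2 * i \<and> y = Suc (2 * i) \<or> x = Suc (2 * i) \<and> y = 2 * i"
  using assms by presburger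

text \<open>The blocks are the sets \<open>{2 i, 2 i + 1}\<close>.\<close>

definition block_perm :: "(nat \<Rightarrow> nat) \<Rightarrow> nat \<Rightarrow> nat" where
  "block_perm p k = 2 * p (k div 2) + k mod 2"

lemma block_perm_simps [simp]:
  "block_perm p (2 * i) = 2 * p i" "block_perm p (Suc (2 * i)) = Suc (2 * p i)"
  "block_perm p k div 2 = p (k div 2)" "block_perm p k mod 2 = k mod 2"
  by (simp_all add: block_perm_def)

lemma block_perm_permutes:
  assumes "p permutes {..<n}"
  shows "block_perm p permutes {..<2 * n}"
proof (rule inj_imp_permutes)
  show "inj_on (block_perm p) {..<2 * n}"
  proof (rule inj_onI)
    fix k l assume "block_perm p k = block_perm p l"
    then have "block_perm p k div 2 = block_perm p l div 2" "block_perm p k mod 2 = block_perm p l mod 2"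
      by simp_all
    then have "p (k div 2) = p (l div 2)" "k mod 2 = l mod 2"
      by simp_all
    then have "k div 2 = l div 2" using permutes_inj[OF assms] by (simp add: inj_eq)
    then show "k = l" using \<open>k mod 2 = l mod 2\<close> by (metis div_mult_mod_eq)
  qed
  show "block_perm p k \<in> {..<2 * n}" if "k \<in> {..<2 * n}" for k
  proof -
    have "p (k div 2) < n" using that permutes_in_image[OF assms, of "k div 2"] by auto
    then have "block_perm p k div 2 < n" by simp
    then show ?thesis by (simp add: div_less_iff_less_mult mult.commute del: block_perm_simps)
  qed
  show "block_perm p k = k" if "k \<notin> {..<2 * n}" for k
  proof -
    have "p (k div 2) = k div 2" using that by (intro permutes_not_in[OF assms]) auto
    then show ?thesis by (simp add: block_perm_def)
  qed
qed simp

text \<open>Exchanging two blocks takes two transpositions of slots, one for the even and one for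
  the odd members.\<close>

lemma sign_block_perm:
  assumes "p permutes {..<n}"
  shows "sign (block_perm p) = 1"
  using assms finite_lessThan
proof (induction p rule: permutes_induct)
  case id
  have "block_perm id = id" by (auto simp: block_perm_def)
  then show ?case by (simp only: sign_id)
next
  case (swap a b p)
  let ?t = "Transposition.transpose"
  have "block_perm (?t a b \<circ> p) = (?t (2 * a) (2 * b) \<circ> ?t (Suc (2 * a)) (Suc (2 * b))) \<circ> block_perm p"
  proof
    fix k
    have ne: "2 * x \<noteq> Suc (2 * y)" "Suc (2 * y) \<noteq> 2 * x" for x y :: nat by presburger+
    have "k = 2 * (k div 2) \<or> k = Suc (2 * (k div 2))" by presburger
    then obtain i where "k = 2 * i \<or> k = Suc (2 * i)" by blast
    then show "block_perm (?t a b \<circ> p) k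
        = ((?t (2 * a) (2 * b) \<circ> ?t (Suc (2 * a)) (Suc (2 * b))) \<circ> block_perm p) k"
      by (elim disjE) (simp_all add: Transposition.transpose_def ne)
  qed
  moreover have "permutation (block_perm p)"
    using block_perm_permutes[OF swap.hyps(4)] by (auto intro: permutes_imp_permutation[rotated])
  ultimately show ?case
    using swap.IH swap.hyps(3)
    by (simp add: sign_compose permutation_swap_id permutation_compose sign_swap_id del: comp_apply o_apply)
qed

definition block_flips :: "nat \<Rightarrow> (nat \<Rightarrow> nat) set" where
  "block_flips n = {\<rho>. \<rho> permutes {..<2 * n} \<and> (\<forall>k. \<rho> k div 2 = k div 2)}"

lemma finite_block_flips: "finite (block_flips n)"
  unfolding block_flips_def by (rule finite_subset[OF _ finite_permutations[of "{..<2 * n}"]]) auto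

text \<open>This cardinality becomes part of the common factor of all evaluations on a frame, so its
  sign is what matters.\<close>

lemma card_block_flips: "card (block_flips n) > 0"
proof -
  have "id \<in> block_flips n" by (simp add: block_flips_def permutes_id)
  then show ?thesis using finite_block_flips by (auto simp: card_gt_0_iff)
qed

text \<open>Each flipped block contributes one transposition; the induction undoes the flip in the
  last block.\<close>

lemma sign_block_flip:
  assumes "\<rho> \<in> block_flips n"
  shows "sign \<rho> = (\<Prod>i<n. if \<rho> (2 * i) = 2 * i then 1 else - 1)"
  using assms
proof (induction n arbitrary: \<rho>)
  case 0
  then show ?case by (simp add: block_flips_def sign_id)
next
  case (Suc n)
  have \<rho>: "\<rho> permutes {..<2 * Suc n}" and d: "\<rho> k div 2 = k div 2" for k
    using Suc.prems by (auto simp: block_flips_def)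
  have inj: "\<rho> a = \<rho> b \<longleftrightarrow> a = b" for a b using permutes_inj[OF \<rho>] by (simp add: inj_eq)
  \<comment> \<open>Preserving blocks and fixing \<open>2 * n\<close> forces the partner to be fixed
    too, so \<tau> lives on the first \<open>n\<close> blocks.\<close>
  have sub: "\<tau> \<in> block_flips n"
    if \<tau>: "\<tau> permutes {..<2 * Suc n}" "\<And>k. \<tau> k div 2 = k div 2" and e: "\<tau> (2 * n) = 2 * n" for \<tau>
  proof -
    have "\<tau> (Suc (2 * n)) \<noteq> \<tau> (2 * n)" using permutes_inj[OF \<tau>(1)] by (simp add: inj_eq)
    moreover have "\<tau> (Suc (2 * n)) div 2 = n" using \<tau>(2)[of "Suc (2 * n)"] by simp
    ultimately have "\<tau> (Suc (2 * n)) = Suc (2 * n)" using e by presburger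
    then have "\<tau> x = x" if "x \<in> {..<2 * Suc n} - {..<2 * n}" for x
      using e that by (cases "x = 2 * n") (auto simp: le_less_Suc_eq)
    then have "\<tau> permutes {..<2 * n}" by (rule permutes_superset[OF \<tau>(1)])
    then show ?thesis using \<tau>(2) by (simp add: block_flips_def)
  qed
  show ?case
  proof (cases "\<rho> (2 * n) = 2 * n")
    case True
    show ?thesis using Suc.IH[OF sub[OF \<rho> d True]] True by simp
  next
    case False
    let ?t = "Transposition.transpose (2 * n) (Suc (2 * n))"
    have t: "?t permutes {..<2 * Suc n}" by (rule permutes_swap_id) auto
    have "\<rho> (2 * n) div 2 = n" using d[of "2 * n"] by simp
    then have r1: "\<rho> (2 * n) = Suc (2 * n)" using False by presburger
    have td: "?t k div 2 = k div 2" for k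
      unfolding Transposition.transpose_def by auto
    have in': "?t \<circ> \<rho> \<in> block_flips n"
      by (rule sub) (use \<rho> t d td r1 in \<open>auto intro: permutes_compose\<close>)
    have "sign (?t \<circ> \<rho>) = - sign \<rho>"
      using \<rho> by (subst sign_compose)
        (auto simp: permutation_swap_id sign_swap_id intro: permutes_imp_permutation[rotated])
    moreover have t_id: "?t (\<rho> (2 * i)) = \<rho> (2 * i)" if "i < n" for i
    proof -
      have "\<rho> (2 * i) div 2 = i" using d[of "2 * i"] by simp
      then have "\<rho> (2 * i) \<noteq> 2 * n" "\<rho> (2 * i) \<noteq> Suc (2 * n)" using that by auto
      then show ?thesis by (rule transpose_apply_other)
    qed
    have "sign (?t \<circ> \<rho>) = (\<Prod>i<n. if \<rho> (2 * i) = 2 * i then 1 else - 1)"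
      unfolding Suc.IH[OF in'] by (rule prod.cong) (simp_all add: t_id)
    ultimately show ?thesis by (simp add: False)
  qed
qed

text \<open>The map induced on blocks, read off at the even slot. It is the identity beyond
  \<open>n\<close> because \<open>permutes\<close> constrains all naturals.\<close>

definition block_part :: "nat \<Rightarrow> (nat \<Rightarrow> nat) \<Rightarrow> nat \<Rightarrow> nat" where
  "block_part n \<sigma> i = (if i < n then \<sigma> (2 * i) div 2 else i)"

text \<open>A block has two elements, and both are already taken by the two slots of
  \<open>i\<close>; no slot of another index can land there.\<close>

lemma block_part_permutes:
  assumes \<sigma>: "\<sigma> permutes {..<2 * n}" and b: "\<And>i. i < n \<Longrightarrow> \<sigma> (2 * i) div 2 = \<sigma> (Suc (2 * i)) div 2"
  shows "block_part n \<sigma> permutes {..<n}"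
proof (rule inj_imp_permutes)
  have inj: "\<sigma> a = \<sigma> b \<longleftrightarrow> a = b" for a b using permutes_inj[OF \<sigma>] by (simp add: inj_eq)
  show "inj_on (block_part n \<sigma>) {..<n}"
  proof (rule inj_onI)
    fix i j assume ij: "i \<in> {..<n}" "j \<in> {..<n}" "block_part n \<sigma> i = block_part n \<sigma> j"
    then have e: "\<sigma> (2 * i) div 2 = \<sigma> (2 * j) div 2" by (simp add: block_part_def)
    have "\<sigma> (2 * i) \<noteq> \<sigma> (Suc (2 * i))" unfolding inj by simp
    from block_cases[OF this e] b[of i] ij(1) e
    have "\<sigma> (2 * j) = \<sigma> (2 * i) \<or> \<sigma> (2 * j) = \<sigma> (Suc (2 * i))"
      using block_cases[of "\<sigma> (2 * i)" "\<sigma> (2 * j)" "\<sigma> (2 * j) div 2"] by (metis lessThan_iff)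
    then have "2 * j = 2 * i \<or> 2 * j = Suc (2 * i)" unfolding inj .
    then show "i = j" by presburger
  qed
  show "block_part n \<sigma> i \<in> {..<n}" if "i \<in> {..<n}" for i
    using that permutes_in_image[OF \<sigma>, of "2 * i"] by (auto simp: block_part_def)
qed (auto simp: block_part_def)

lemma broken_block_other:
  assumes \<sigma>: "\<sigma> permutes {..<2 * n}" and i: "i < n" and br: "\<sigma> (2 * i) div 2 \<noteq> \<sigma> (Suc (2 * i)) div 2"
  shows "\<exists>j<n. j \<noteq> i \<and> \<sigma> (2 * j) div 2 \<noteq> \<sigma> (Suc (2 * j)) div 2"
proof -
  have inj: "\<sigma> a = \<sigma> b \<longleftrightarrow> a = b" for a b using permutes_inj[OF \<sigma>] by (simp add: inj_eq)
  \<comment> \<open>The partner \<open>a'\<close> of \<open>a\<close> in its block must come from another index, whose block is then broken too.\<close>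
  define a where "a = \<sigma> (2 * i)"
  define a' where "a' = (if even a then Suc a else a - 1)"
  have a': "a' \<noteq> a" "a' div 2 = a div 2" unfolding a'_def by (auto elim!: evenE oddE)
  have "a < 2 * n" using permutes_in_image[OF \<sigma>, of "2 * i"] i by (simp add: a_def)
  then have "a' < 2 * n" using a'(2) by (metis div_less_iff_less_mult mult.commute pos2)
  obtain k where k: "\<sigma> k = a'" using permutes_surj[OF \<sigma>] by (metis surjD)
  have kn: "k < 2 * n" using permutes_in_image[OF \<sigma>, of k] k \<open>a' < 2 * n\<close> by simp
  define j where "j = k div 2"
  have kj: "k = 2 * j \<or> k = Suc (2 * j)" unfolding j_def by presburger
  \<comment> \<open>With \<open>k\<close> in block \<open>i\<close>, either \<open>a' = a\<close> or
    the two images of block \<open>i\<close> would share a block.\<close>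
  have ji: "j \<noteq> i"
    using kj k a' br unfolding a_def by metis
  \<comment> \<open>Otherwise the images of block \<open>j\<close> would be exactly \<open>a\<close>
    and \<open>a'\<close>, and injectivity would put slot \<open>2 * i\<close> into block
    \<open>j\<close>.\<close>
  have "\<sigma> (2 * j) div 2 \<noteq> \<sigma> (Suc (2 * j)) div 2"
  proof
    assume e: "\<sigma> (2 * j) div 2 = \<sigma> (Suc (2 * j)) div 2"
    have "\<sigma> (2 * j) \<noteq> \<sigma> (Suc (2 * j))" unfolding inj by simp
    have "a div 2 = \<sigma> (2 * j) div 2" using e kj k a' by metis
    then have "a = \<sigma> (2 * j) \<or> a = \<sigma> (Suc (2 * j))"
      using block_cases[OF \<open>\<sigma> (2 * j) \<noteq> _\<close> refl e[symmetric]] block_cases[OF \<open>a' \<noteq> a\<close> a'(2) refl]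
      by metis
    then have "2 * i = 2 * j \<or> 2 * i = Suc (2 * j)" unfolding a_def inj .
    then show False using ji by presburger
  qed
  then show ?thesis using ji kn by (intro exI[of _ j]) (auto simp: j_def)
qed

text \<open>
  Only the permutations that map blocks to blocks contribute, and each of these is a permutation
  of the blocks composed with flips inside them. The sign of the flips cancels against \<open>anti\<close>.
  One factor \<open>i0\<close> need not be block diagonal because a permutation never breaks exactly one block.
\<close>

lemma sum_block_diagonal:
  fixes a :: "nat \<Rightarrow> nat \<Rightarrow> nat \<Rightarrow> real"
  assumes anti: "\<And>i k l. i < n \<Longrightarrow> a i k l = - a i l k"
    and diag: "\<And>i k l. i < n \<Longrightarrow> i \<noteq> i0 \<Longrightarrow> k < 2 * n \<Longrightarrow> l < 2 * n \<Longrightarrow> k div 2 \<noteq> l div 2 \<Longrightarrow> a i k l = 0"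
  shows "(\<Sum>\<sigma> | \<sigma> permutes {..<2 * n}. of_int (sign \<sigma>) * (\<Prod>i<n. a i (\<sigma> (2 * i)) (\<sigma> (Suc (2 * i)))))
       = real (card (block_flips n)) *
         (\<Sum>\<pi> | \<pi> permutes {..<n}. \<Prod>i<n. a i (2 * \<pi> i) (Suc (2 * \<pi> i)))"
proof -
  define T where "T = (\<lambda>\<sigma>. of_int (sign \<sigma>) * (\<Prod>i<n. a i (\<sigma> (2 * i)) (\<sigma> (Suc (2 * i)))))"
  define B where "B = {\<sigma>. \<sigma> permutes {..<2 * n} \<and> (\<forall>i<n. \<sigma> (2 * i) div 2 = \<sigma> (Suc (2 * i)) div 2)}"
  let ?P = "{\<pi>. \<pi> permutes {..<n}}"
  have "sum T {\<sigma>. \<sigma> permutes {..<2 * n}} = sum T B"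
  proof (rule sum.mono_neutral_right)
    show "\<forall>\<sigma>\<in>{\<sigma>. \<sigma> permutes {..<2 * n}} - B. T \<sigma> = 0"
    proof
      fix \<sigma> assume "\<sigma> \<in> {\<sigma>. \<sigma> permutes {..<2 * n}} - B"
      then obtain i where \<sigma>: "\<sigma> permutes {..<2 * n}"
        and i: "i < n" "\<sigma> (2 * i) div 2 \<noteq> \<sigma> (Suc (2 * i)) div 2"
        by (auto simp: B_def)
      \<comment> \<open>If the broken block at hand is the exceptional \<open>i0\<close>, a second
        broken one takes its place.\<close>
      obtain j where j: "j < n" "j \<noteq> i0" "\<sigma> (2 * j) div 2 \<noteq> \<sigma> (Suc (2 * j)) div 2"
        using broken_block_other[OF \<sigma> i] i by (cases "i = i0") auto
      have "a j (\<sigma> (2 * j)) (\<sigma> (Suc (2 * j))) = 0"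
        using j permutes_in_image[OF \<sigma>, of "2 * j"] permutes_in_image[OF \<sigma>, of "Suc (2 * j)"]
        by (intro diag) auto
      then have "(\<Prod>i<n. a i (\<sigma> (2 * i)) (\<sigma> (Suc (2 * i)))) = 0"
        using j by (intro prod_zero) auto
      then show "T \<sigma> = 0" by (simp add: T_def)
    qed
  qed (auto simp: B_def finite_permutations)
  also have "sum T B = (\<Sum>(\<pi>, \<rho>)\<in>?P \<times> block_flips n. \<Prod>i<n. a i (2 * \<pi> i) (Suc (2 * \<pi> i)))"
  \<comment> \<open>Unique factorisation: \<open>block_part\<close> gives the permutation of blocks,
    and dividing it out leaves a flip.\<close>
  proof (rule sum.reindex_bij_witness[where
        i = "\<lambda>(\<pi>, \<rho>). block_perm \<pi> \<circ> \<rho>" and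
        j = "\<lambda>\<sigma>. (block_part n \<sigma>, inv (block_perm (block_part n \<sigma>)) \<circ> \<sigma>)"])
    fix \<sigma> assume "\<sigma> \<in> B"
    then have \<sigma>: "\<sigma> permutes {..<2 * n}"
      and b: "\<And>i. i < n \<Longrightarrow> \<sigma> (2 * i) div 2 = \<sigma> (Suc (2 * i)) div 2" by (auto simp: B_def)
    let ?\<pi> = "block_part n \<sigma>"
    let ?d = "block_perm ?\<pi>"
    have \<pi>: "?\<pi> permutes {..<n}" by (rule block_part_permutes[OF \<sigma> b])
    have d: "?d permutes {..<2 * n}" by (rule block_perm_permutes[OF \<pi>])
    define \<rho> where "\<rho> = inv ?d \<circ> \<sigma>"
    show eq: "(case (?\<pi>, inv ?d \<circ> \<sigma>) of (\<pi>, \<rho>) \<Rightarrow> block_perm \<pi> \<circ> \<rho>) = \<sigma>"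
      using permutes_inv_o(1)[OF d] by (simp add: o_assoc)
    have d\<rho>: "?d (\<rho> k) = \<sigma> k" for k using fun_cong[OF eq, of k] by (simp add: \<rho>_def)
    have \<rho>p: "\<rho> permutes {..<2 * n}"
      unfolding \<rho>_def by (rule permutes_compose[OF \<sigma> permutes_inv[OF d]])
    have \<rho>d: "\<rho> k div 2 = k div 2" for k
    proof (cases "k < 2 * n")
      case True
      have kk: "k = 2 * (k div 2) \<or> k = Suc (2 * (k div 2))" by presburger
      have "?\<pi> (\<rho> k div 2) = \<sigma> k div 2" by (simp flip: block_perm_simps(3) add: d\<rho>)
      also have "\<sigma> k div 2 = ?\<pi> (k div 2)"
        using b[of "k div 2"] True kk by (auto simp: block_part_def)
      finally show ?thesis using permutes_inj[OF \<pi>] by (simp add: inj_eq)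
    next
      case False
      then show ?thesis using permutes_not_in[OF \<rho>p, of k] by simp
    qed
    have flip: "\<rho> \<in> block_flips n" using \<rho>p \<rho>d by (simp add: block_flips_def)
    show "(?\<pi>, inv ?d \<circ> \<sigma>) \<in> ?P \<times> block_flips n"
      using \<pi> flip by (simp add: \<rho>_def)
    have s: "sign \<sigma> = sign \<rho>"
    proof -
      have "sign \<sigma> = sign (?d \<circ> \<rho>)" using d\<rho> by (auto intro!: arg_cong[where f=sign])
      also have "\<dots> = sign ?d * sign \<rho>"
        using d \<rho>p by (intro sign_compose) (auto intro: permutes_imp_permutation[rotated])
      finally show ?thesis by (simp add: sign_block_perm[OF \<pi>])
    qed
    have fac: "a i (\<sigma> (2 * i)) (\<sigma> (Suc (2 * i)))
        = (if \<rho> (2 * i) = 2 * i then 1 else - 1) * a i (2 * ?\<pi> i) (Suc (2 * ?\<pi> i))" if i: "i < n" for i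
    proof -
      have ne: "\<rho> (2 * i) \<noteq> \<rho> (Suc (2 * i))"
        using permutes_inj[OF \<rho>p] by (simp add: inj_eq)
      have dd: "\<rho> (2 * i) div 2 = i" "\<rho> (Suc (2 * i)) div 2 = i"
        using \<rho>d[of "2 * i"] \<rho>d[of "Suc (2 * i)"] by auto
      consider "\<rho> (2 * i) = 2 * i" "\<rho> (Suc (2 * i)) = Suc (2 * i)"
        | "\<rho> (2 * i) = Suc (2 * i)" "\<rho> (Suc (2 * i)) = 2 * i"
        using block_cases[OF ne dd] by blast
      then show ?thesis
        using anti[OF i, of "Suc (2 * ?\<pi> i)" "2 * ?\<pi> i"]
        by cases (simp_all flip: d\<rho>)
    qed
    \<comment> \<open>The product is the sign of \<rho> once more, so the sign is squared.\<close>
    have "of_int (sign \<rho>) * (\<Prod>i<n. if \<rho> (2 * i) = 2 * i then 1 else - 1) = (1::real)"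
    proof -
      have "(\<Prod>i<n. if \<rho> (2 * i) = 2 * i then 1 else - 1) = real_of_int (sign \<rho>)"
        unfolding sign_block_flip[OF flip] of_int_prod by (intro prod.cong) auto
      then show ?thesis by (simp add: sign_def)
    qed
    then show "(case (?\<pi>, inv ?d \<circ> \<sigma>) of (\<pi>, \<rho>) \<Rightarrow> \<Prod>i<n. a i (2 * \<pi> i) (Suc (2 * \<pi> i))) = T \<sigma>"
      by (simp add: T_def s fac prod.distrib flip: mult.assoc)
  next
    fix x assume x: "x \<in> ?P \<times> block_flips n"
    obtain \<pi> \<rho> where x': "x = (\<pi>, \<rho>)" by (cases x)
    have \<pi>: "\<pi> permutes {..<n}" and \<rho>: "\<rho> permutes {..<2 * n}" "\<And>k. \<rho> k div 2 = k div 2"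
      using x by (auto simp: x' block_flips_def)
    have d: "block_perm \<pi> permutes {..<2 * n}" by (rule block_perm_permutes[OF \<pi>])
    have "block_part n (block_perm \<pi> \<circ> \<rho>) = \<pi>"
      using permutes_not_in[OF \<pi>] by (auto simp: block_part_def \<rho>(2))
    then show "(block_part n (case x of (\<pi>, \<rho>) \<Rightarrow> block_perm \<pi> \<circ> \<rho>),
          inv (block_perm (block_part n (case x of (\<pi>, \<rho>) \<Rightarrow> block_perm \<pi> \<circ> \<rho>))) \<circ>
          (case x of (\<pi>, \<rho>) \<Rightarrow> block_perm \<pi> \<circ> \<rho>)) = x"
      using permutes_inv_o(2)[OF d] by (simp add: x' o_assoc)
    show "(case x of (\<pi>, \<rho>) \<Rightarrow> block_perm \<pi> \<circ> \<rho>) \<in> B"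
      using permutes_compose[OF \<rho>(1) d] by (simp add: x' B_def \<rho>(2))
  qed
  also have "\<dots> = real (card (block_flips n)) *
      (\<Sum>\<pi>\<in>?P. \<Prod>i<n. a i (2 * \<pi> i) (Suc (2 * \<pi> i)))"
    by (simp add: sum.cartesian_product[symmetric] sum_distrib_left)
  finally show ?thesis by (simp add: T_def)
qed

section \<open>Adapted frames\<close>

text \<open>For positive \<alpha> of type (1,1), \<open>pairing \<alpha> u (\<i> *s v)\<close> is
  the associated real inner product. Together with \<open>pairing \<alpha> u v\<close> it carries
  the real and imaginary parts of the Hermitian product, so complex orthogonality is always stated
  as a pair of equations.\<close>

definition pairing :: "'n::finite form \<Rightarrow> complex ^ 'n \<Rightarrow> complex ^ 'n \<Rightarrow> real" where
  "pairing \<alpha> u v = \<alpha> (\<lambda>i. if i = 0 then u else v)"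

lemma alternating_form_2_pairing:
  assumes "alternating_form 2 \<alpha>"
  shows "\<alpha> v = pairing \<alpha> (v 0) (v 1)"
  unfolding pairing_def by (rule alternating_form_cong[OF assms]) (auto simp: less_2_cases_iff)

lemma real_pp_form_1_alternating: "real_pp_form 1 \<alpha> \<Longrightarrow> alternating_form 2 \<alpha>"
  by (simp add: real_pp_form_def)

lemma linear_pairing:
  assumes "real_pp_form 1 \<alpha>"
  shows linear_pairing_left: "linear (\<lambda>u. pairing \<alpha> u v)"
    and linear_pairing_right: "linear (\<lambda>u. pairing \<alpha> v u)"
proof -
  note alt = real_pp_form_1_alternating[OF assms]
  have "\<alpha> ((\<lambda>_. v)(0 := u)) = pairing \<alpha> u v" "\<alpha> ((\<lambda>_. v)(1 := u)) = pairing \<alpha> v u" for u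
    by (simp_all add: alternating_form_2_pairing[OF alt])
  then show "linear (\<lambda>u. pairing \<alpha> u v)" "linear (\<lambda>u. pairing \<alpha> v u)"
    using alternating_form_linear[OF alt, of 0 "\<lambda>_. v"] alternating_form_linear[OF alt, of 1 "\<lambda>_. v"]
    by simp_all
qed

lemma pairing_self:
  assumes "real_pp_form 1 \<alpha>"
  shows "pairing \<alpha> u u = 0"
  unfolding pairing_def
  by (rule alternating_form_eq[OF real_pp_form_1_alternating[OF assms], of 0 1]) auto

lemma pairing_commute:
  assumes "real_pp_form 1 \<alpha>"
  shows "pairing \<alpha> u v = - pairing \<alpha> v u"
proof -
  have "pairing \<alpha> (u + v) (u + v)
      = pairing \<alpha> u u + pairing \<alpha> u v + (pairing \<alpha> v u + pairing \<alpha> v v)"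
    by (simp only: linear_add[OF linear_pairing_left[OF assms]]
        linear_add[OF linear_pairing_right[OF assms]] ac_simps)
  then show ?thesis unfolding pairing_self[OF assms] by linarith
qed

lemma pairing_ii:
  assumes "real_pp_form 1 \<alpha>"
  shows "pairing \<alpha> (\<i> *s u) (\<i> *s v) = pairing \<alpha> u v"
proof -
  have "\<alpha> (\<lambda>i. \<i> *s (if i = 0 then u else v)) = pairing \<alpha> u v"
    using assms unfolding real_pp_form_def pairing_def by (metis norm_ii)
  then show ?thesis by (simp add: pairing_def if_distrib)
qed

lemma ii_ii_scale: "\<i> *s (\<i> *s u) = - (u :: complex ^ 'n)"
  by (simp add: vec_eq_iff)

lemma pairing_ii_left:
  assumes "real_pp_form 1 \<alpha>"
  shows "pairing \<alpha> (\<i> *s u) v = - pairing \<alpha> u (\<i> *s v)"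
proof -
  have "pairing \<alpha> (\<i> *s u) v = pairing \<alpha> (\<i> *s (\<i> *s u)) (\<i> *s v)"
    by (simp only: pairing_ii[OF assms])
  then show ?thesis
    by (simp add: ii_ii_scale linear_neg[OF linear_pairing_left[OF assms]])
qed

text \<open>The argument list on which \<open>positive_top\<close> evaluates a form;
  \<open>c j\<close> and \<open>\<i> *s c j\<close> fill block \<open>j\<close>.\<close>

definition frame :: "(nat \<Rightarrow> complex ^ 'n::finite) \<Rightarrow> nat \<Rightarrow> complex ^ 'n" where
  "frame c = (\<lambda>i. if even i then c (i div 2) else \<i> *s c (i div 2))"

lemma frame_simps [simp]: "frame c (2 * j) = c j" "frame c (Suc (2 * j)) = \<i> *s c j"
  by (simp_all add: frame_def)

lemma frame_cases:
  obtains j where "i = 2 * j" "frame c i = c j" | j where "i = Suc (2 * j)" "frame c i = \<i> *s c j"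
  by (cases "even i") (auto elim!: evenE oddE)

text \<open>Since \<open>\<i>\<close> can be moved across the pairing at the cost of a sign, the
  four combinations of slots from two blocks reduce to the two given ones.\<close>

lemma frame_off_block:
  assumes \<alpha>: "real_pp_form 1 \<alpha>"
    and off: "pairing \<alpha> (c (k div 2)) (c (l div 2)) = 0"
      "pairing \<alpha> (c (k div 2)) (\<i> *s c (l div 2)) = 0"
  shows "pairing \<alpha> (frame c k) (frame c l) = 0"
  unfolding frame_def using off 
  by (simp add: pairing_ii[OF \<alpha>] pairing_ii_left[OF \<alpha>] ii_ii_scale linear_neg[OF linear_pairing_right[OF \<alpha>]])

text \<open>The sum over \<pi> is the permanent of the matrix of diagonal entries, a polarised
  determinant. The index \<open>s\<close> marks the one factor that may have off-diagonal
  entries.\<close>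

lemma mixed_frame:
  assumes \<alpha>: "\<And>i. i < n \<Longrightarrow> real_pp_form 1 (\<alpha> i)"
    and off: "\<And>i j k. i < n \<Longrightarrow> i \<noteq> s \<Longrightarrow> j < n \<Longrightarrow> k < n \<Longrightarrow> j \<noteq> k \<Longrightarrow>
      pairing (\<alpha> i) (c j) (c k) = 0 \<and> pairing (\<alpha> i) (c j) (\<i> *s c k) = 0"
  shows "mixed n \<alpha> (frame c) = real (card (block_flips n)) / 2 ^ n *
    (\<Sum>\<pi> | \<pi> permutes {..<n}. \<Prod>i<n. pairing (\<alpha> i) (c (\<pi> i)) (\<i> *s c (\<pi> i)))"
proof -
  define a where "a = (\<lambda>i k l. pairing (\<alpha> i) (frame c k) (frame c l))"
  have "mixed n \<alpha> (frame c) = (\<Sum>\<sigma> | \<sigma> permutes {..<2 * n}.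
      of_int (sign \<sigma>) * (\<Prod>i<n. a i (\<sigma> (2 * i)) (\<sigma> (Suc (2 * i))))) / 2 ^ n"
    unfolding mixed_def
  proof (rule arg_cong2[where f="(/)"], rule sum.cong, rule refl, rule arg_cong2[where f="(*)"],
      rule refl, rule prod.cong, rule refl)
    fix \<sigma> i assume "i \<in> {..<n}"
    then have "alternating_form 2 (\<alpha> i)" using \<alpha> real_pp_form_1_alternating by auto
    from alternating_form_2_pairing[OF this]
    show "\<alpha> i (\<lambda>l. frame c (\<sigma> (2 * i + l))) = a i (\<sigma> (2 * i)) (\<sigma> (Suc (2 * i)))"
      by (simp add: a_def)
  qed (rule refl)
  also have "(\<Sum>\<sigma> | \<sigma> permutes {..<2 * n}.
      of_int (sign \<sigma>) * (\<Prod>i<n. a i (\<sigma> (2 * i)) (\<sigma> (Suc (2 * i))))) =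
      real (card (block_flips n)) *
      (\<Sum>\<pi> | \<pi> permutes {..<n}. \<Prod>i<n. a i (2 * \<pi> i) (Suc (2 * \<pi> i)))"
  proof (rule sum_block_diagonal)
    show "a i k l = - a i l k" if "i < n" for i k l
      unfolding a_def by (rule pairing_commute[OF \<alpha>[OF that]])
    show "a i k l = 0" if "i < n" "i \<noteq> s" "k < 2 * n" "l < 2 * n" "k div 2 \<noteq> l div 2" for i k l
    proof -
      have "k div 2 < n" "l div 2 < n" using that by auto
      with off[OF that(1,2) _ _ that(5)] show ?thesis
        unfolding a_def using frame_off_block[OF \<alpha>[OF that(1)], of c k l] by blast
    qed
  qed
  finally show ?thesis by (simp add: a_def)
qed

section \<open>Real spans of frames and orthogonal projection\<close>

lemma linear_complex_scale: "linear ((*s) z :: complex ^ 'n \<Rightarrow> complex ^ 'n)"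
  by (rule linearI) (simp_all add: vec_eq_iff algebra_simps)

text \<open>Multiplication by \<open>\<i>\<close> exchanges the two vectors of a block up to sign,
  so the real span is a complex subspace.\<close>

lemma ii_scale_in_span_frame:
  assumes "y \<in> span (frame c ` {..<2 * k})"
  shows "\<i> *s y \<in> span (frame c ` {..<2 * k})"
proof -
  have "(*s) \<i> ` frame c ` {..<2 * k} \<subseteq> span (frame c ` {..<2 * k})"
  proof clarify
    fix l assume l: "l < 2 * k"
    show "\<i> *s frame c l \<in> span (frame c ` {..<2 * k})"
    proof (cases rule: frame_cases[of l c])
      case (1 j)
      then have "\<i> *s frame c l = frame c (Suc (2 * j))" by simp
      moreover have "Suc (2 * j) < 2 * k" using 1 l by presburger
      ultimately show ?thesis by (metis imageI lessThan_iff span_base)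
    next
      case (2 j)
      then have "\<i> *s frame c l = - frame c (2 * j)" by (simp add: ii_ii_scale)
      moreover have "2 * j < 2 * k" using 2 l by presburger
      ultimately show ?thesis by (metis imageI lessThan_iff span_base span_neg)
    qed
  qed
  then have "span ((*s) \<i> ` frame c ` {..<2 * k}) \<subseteq> span (frame c ` {..<2 * k})"
    by (rule span_minimal[OF _ subspace_span])
  then show ?thesis
    using assms linear_span_image[OF linear_complex_scale, of \<i> "frame c ` {..<2 * k}"] by blast
qed

lemma orthogonal_projection_frame:
  fixes k :: nat
  assumes \<eta>: "real_pp_form 1 \<eta>"
    and d: "\<And>i. i < k \<Longrightarrow> pairing \<eta> (c i) (\<i> *s c i) \<noteq> 0"
    and orth: "\<And>i j. i < k \<Longrightarrow> j < k \<Longrightarrow> i \<noteq> j \<Longrightarrow>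
      pairing \<eta> (c i) (c j) = 0 \<and> pairing \<eta> (c i) (\<i> *s c j) = 0"
  shows "\<exists>y \<in> span (frame c ` {..<2 * k}). \<forall>j<k.
    pairing \<eta> y (c j) = pairing \<eta> v (c j) \<and> pairing \<eta> y (\<i> *s c j) = pairing \<eta> v (\<i> *s c j)"
proof -
  define D where "D = (\<lambda>i. pairing \<eta> (c i) (\<i> *s c i))"
  \<comment> \<open>Fourier coefficients along \<open>c i\<close> and \<open>\<i> *s c i\<close>,
    which are orthogonal for the symmetric form \<open>pairing \<eta> u (\<i> *s v)\<close> and both
    have square \<open>D i\<close>; the minus sign in \<open>Q\<close> is the square of
    \<open>\<i>\<close>.\<close>
  define P where "P = (\<lambda>i. pairing \<eta> v (\<i> *s c i) / D i)"
  define Q where "Q = (\<lambda>i. - pairing \<eta> v (c i) / D i)"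
  define y where "y = (\<Sum>i<k. P i *\<^sub>R c i + Q i *\<^sub>R (\<i> *s c i))"
  note linL = linear_pairing_left[OF \<eta>]
  have expand: "pairing \<eta> y u = (\<Sum>i<k. P i * pairing \<eta> (c i) u - Q i * pairing \<eta> (c i) (\<i> *s u))" for u
    unfolding y_def
    by (simp add: linear_sum[OF linL] linear_add[OF linL] linear_scale[OF linL] pairing_ii_left[OF \<eta>])
  have "pairing \<eta> y (c j) = pairing \<eta> v (c j) \<and> pairing \<eta> y (\<i> *s c j) = pairing \<eta> v (\<i> *s c j)"
    if j: "j < k" for j
  proof
    have "P i * pairing \<eta> (c i) (c j) - Q i * pairing \<eta> (c i) (\<i> *s c j)
        = (if i = j then pairing \<eta> v (c j) else 0)" if "i < k" for i
      using orth[OF that j] d[OF j] by (auto simp: pairing_self[OF \<eta>] Q_def D_def)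
    then have "pairing \<eta> y (c j) = (\<Sum>i<k. if i = j then pairing \<eta> v (c j) else 0)"
      unfolding expand by (intro sum.cong) simp_all
    then show "pairing \<eta> y (c j) = pairing \<eta> v (c j)" using j by simp
    have neg: "pairing \<eta> u (- w) = - pairing \<eta> u w" for u w
      by (rule linear_neg[OF linear_pairing_right[OF \<eta>]])
    have "P i * pairing \<eta> (c i) (\<i> *s c j) - Q i * pairing \<eta> (c i) (\<i> *s (\<i> *s c j))
        = (if i = j then pairing \<eta> v (\<i> *s c j) else 0)" if "i < k" for i
      using orth[OF that j] d[OF j] by (auto simp: pairing_self[OF \<eta>] P_def D_def ii_ii_scale neg)
    then have "pairing \<eta> y (\<i> *s c j) = (\<Sum>i<k. if i = j then pairing \<eta> v (\<i> *s c j) else 0)"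
      unfolding expand by (intro sum.cong) simp_all
    then show "pairing \<eta> y (\<i> *s c j) = pairing \<eta> v (\<i> *s c j)" using j by simp
  qed
  moreover have "y \<in> span (frame c ` {..<2 * k})"
    unfolding y_def
  proof (intro span_sum span_add span_scale)
    fix i assume "i \<in> {..<k}"
    then have "2 * i < 2 * k" "Suc (2 * i) < 2 * k" by auto
    then have "frame c (2 * i) \<in> frame c ` {..<2 * k}" "frame c (Suc (2 * i)) \<in> frame c ` {..<2 * k}"
      by blast+
    then show "c i \<in> span (frame c ` {..<2 * k})" "\<i> *s c i \<in> span (frame c ` {..<2 * k})"
      using span_base by (simp_all del: span_base)
  qed
  ultimately show ?thesis by blast
qed

section \<open>Positivity of the top power on every complex basis\<close>

lemma positive_11D:
  assumes "positive_11 \<eta>"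
  shows positive_11_real_pp_form: "real_pp_form 1 \<eta>"
    and positive_11_pairing: "u \<noteq> 0 \<Longrightarrow> pairing \<eta> u (\<i> *s u) > 0"
  using assms unfolding positive_11_def pairing_def by auto

text \<open>Changing \<open>c k\<close> alters two slots, by \<open>y\<close> and by
  \<open>\<i> *s y\<close>; both increments lie in the span of the earlier slots.\<close>

lemma alternating_form_frame_add:
  fixes n :: nat
  assumes \<tau>: "alternating_form (2 * n) \<tau>" and k: "k < n" and y: "y \<in> span (frame c ` {..<2 * k})"
  shows "\<tau> (frame (c(k := c k + y))) = \<tau> (frame c)"
proof -
  define v where "v = (frame c)(2 * k := frame c (2 * k) + y)"
  have iy: "\<i> *s y \<in> span (frame c ` {..<2 * k})" by (rule ii_scale_in_span_frame[OF y])
  have "frame (c(k := c k + y)) = v(Suc (2 * k) := v (Suc (2 * k)) + \<i> *s y)"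
  proof
    fix i show "frame (c(k := c k + y)) i = (v(Suc (2 * k) := v (Suc (2 * k)) + \<i> *s y)) i"
    proof (cases rule: frame_cases[of i c])
      case (1 j)
      then show ?thesis by (auto simp: v_def)
    next
      case (2 j)
      have "2 * j \<noteq> Suc (2 * k)" "Suc (2 * j) \<noteq> 2 * k" for j by presburger+
      with 2 show ?thesis by (auto simp: v_def linear_add[OF linear_complex_scale])
    qed
  qed
  then have "\<tau> (frame (c(k := c k + y))) = \<tau> (v(Suc (2 * k) := v (Suc (2 * k)) + \<i> *s y))"
    by (rule arg_cong)
  also have "\<dots> = \<tau> v"
  proof (rule alternating_form_add_span[OF \<tau>])
    have "frame c ` {..<2 * k} \<subseteq> v ` ({..<2 * n} - {Suc (2 * k)})"
    proof clarify
      fix l assume "l < 2 * k"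
      then have "frame c l = v l" "l \<in> {..<2 * n} - {Suc (2 * k)}" using k by (auto simp: v_def)
      then show "frame c l \<in> v ` ({..<2 * n} - {Suc (2 * k)})" by blast
    qed
    then show "\<i> *s y \<in> span (v ` ({..<2 * n} - {Suc (2 * k)}))"
      using iy span_mono by blast
  qed (use k in simp)
  also have "\<tau> v = \<tau> (frame c)"
    unfolding v_def
  proof (rule alternating_form_add_span[OF \<tau>])
    have "frame c ` {..<2 * k} \<subseteq> frame c ` ({..<2 * n} - {2 * k})" using k by (intro image_mono) auto
    then show "y \<in> span (frame c ` ({..<2 * n} - {2 * k}))"
      using y span_mono by blast
  qed (use k in simp)
  finally show ?thesis .
qed

text \<open>
  Orthogonalising one vector at a time adds to each \<open>b k\<close> complex multiples of earlier vectors,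
  which does not change an alternating form.
\<close>

lemma gram_schmidt_frame:
  fixes n :: nat
  assumes \<eta>: "positive_11 \<eta>" and \<tau>: "alternating_form (2 * n) \<tau>"
    and inj: "inj_on b {..<n}" and ind: "vec.independent (b ` {..<n})" and "k \<le> n"
  shows "\<exists>c. (\<forall>i<k. c i \<in> vec.span (b ` {..<k}) \<and> c i \<noteq> 0) \<and> (\<forall>i\<ge>k. c i = b i) \<and>
    (\<forall>i<k. \<forall>j<k. i \<noteq> j \<longrightarrow> pairing \<eta> (c i) (c j) = 0 \<and> pairing \<eta> (c i) (\<i> *s c j) = 0) \<and>
    \<tau> (frame c) = \<tau> (frame b)"
  using \<open>k \<le> n\<close>
proof (induction k)
  case 0
  then show ?case by auto
next
  case (Suc k)
  note \<eta>r = positive_11_real_pp_form[OF \<eta>]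
  obtain c where IH: "\<forall>i<k. c i \<in> vec.span (b ` {..<k}) \<and> c i \<noteq> 0" "\<forall>i\<ge>k. c i = b i"
    "\<forall>i<k. \<forall>j<k. i \<noteq> j \<longrightarrow> pairing \<eta> (c i) (c j) = 0 \<and> pairing \<eta> (c i) (\<i> *s c j) = 0"
    and \<tau>c: "\<tau> (frame c) = \<tau> (frame b)"
    using Suc.IH[OF Suc_leD[OF Suc.prems]] by (elim exE conjE) (erule (3) that)
  have c: "\<And>i. i < k \<Longrightarrow> c i \<in> vec.span (b ` {..<k})" "\<And>i. i < k \<Longrightarrow> c i \<noteq> 0"
    and cb: "\<And>i. i \<ge> k \<Longrightarrow> c i = b i"
    and orth: "\<And>i j. i < k \<Longrightarrow> j < k \<Longrightarrow> i \<noteq> j \<Longrightarrow>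
      pairing \<eta> (c i) (c j) = 0 \<and> pairing \<eta> (c i) (\<i> *s c j) = 0"
    using IH by simp_all
  have k: "k < n" using Suc.prems by simp
  have d: "pairing \<eta> (c i) (\<i> *s c i) \<noteq> 0" if "i < k" for i
    using positive_11_pairing[OF \<eta> c(2)[OF that]] by simp
  obtain y where y: "y \<in> span (frame c ` {..<2 * k})"
    and yj: "\<And>j. j < k \<Longrightarrow> pairing \<eta> y (c j) = pairing \<eta> (b k) (c j)"
      "\<And>j. j < k \<Longrightarrow> pairing \<eta> y (\<i> *s c j) = pairing \<eta> (b k) (\<i> *s c j)"
    using orthogonal_projection_frame[where k = k and c = c and v = "b k", OF \<eta>r d orth] by blast
  define u where "u = b k - y"
  have u1: "pairing \<eta> u (c j) = 0" "pairing \<eta> u (\<i> *s c j) = 0" if "j < k" for j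
    using yj[OF that] by (simp_all add: u_def linear_diff[OF linear_pairing_left[OF \<eta>r]])
  have u2: "pairing \<eta> (c j) u = 0" "pairing \<eta> (c j) (\<i> *s u) = 0" if "j < k" for j
  proof -
    show "pairing \<eta> (c j) u = 0" using u1[OF that] pairing_commute[OF \<eta>r, of u "c j"] by simp
    show "pairing \<eta> (c j) (\<i> *s u) = 0"
      using u1[OF that] pairing_commute[OF \<eta>r, of "c j" "\<i> *s u"] pairing_ii_left[OF \<eta>r, of u "c j"]
      by simp
  qed
  have sub: "vec.span (b ` {..<k}) \<subseteq> vec.span (b ` {..<Suc k})"
    by (rule vec.span_mono) auto
  \<comment> \<open>The projection \<open>y\<close> is found in a real span, while independence of
    \<open>b\<close> is complex; this links the two.\<close>
  have "subspace (vec.span (b ` {..<k}))"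
  proof (rule subspaceI)
    fix r :: real and x assume "x \<in> vec.span (b ` {..<k})"
    then have "complex_of_real r *s x \<in> vec.span (b ` {..<k})" by (rule vec.span_scale)
    moreover have "complex_of_real r *s x = r *\<^sub>R x" 
      by (simp add: vec_eq_iff scaleR_conv_of_real[where 'a = complex])
    ultimately show "r *\<^sub>R x \<in> vec.span (b ` {..<k})" by simp
  qed (auto intro: vec.span_zero vec.span_add)
  moreover have "frame c ` {..<2 * k} \<subseteq> vec.span (b ` {..<k})"
    using c(1) by (auto simp: frame_def intro!: vec.span_scale)
  ultimately have yb: "y \<in> vec.span (b ` {..<k})"
    using y span_minimal by blast
  have "b k \<notin> vec.span (b ` {..<k})"
  proof
    assume "b k \<in> vec.span (b ` {..<k})"
    moreover have "b ` {..<k} \<subseteq> b ` {..<n} - {b k}"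
      using inj k by (auto simp: inj_on_def)
    ultimately have "b k \<in> vec.span (b ` {..<n} - {b k})"
      using vec.span_mono by blast
    then show False using ind k unfolding vec.dependent_def by blast
  qed
  then have u0: "u \<noteq> 0" using yb by (auto simp: u_def)
  have ub: "u \<in> vec.span (b ` {..<Suc k})"
    unfolding u_def
  proof (rule vec.span_diff)
    show "b k \<in> vec.span (b ` {..<Suc k})" by (rule vec.span_base) simp
    show "y \<in> vec.span (b ` {..<Suc k})" using yb sub by blast
  qed
  define c' where "c' = c(k := u)"
  have "c k + - y = u" by (simp add: u_def cb)
  then have "\<tau> (frame c') = \<tau> (frame b)"
    using alternating_form_frame_add[OF \<tau> k span_neg[OF y]] \<tau>c by (simp add: c'_def)
  moreover have "\<forall>i<Suc k. c' i \<in> vec.span (b ` {..<Suc k}) \<and> c' i \<noteq> 0"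
    using c sub u0 ub by (auto simp: c'_def less_Suc_eq)
  moreover have "\<forall>i\<ge>Suc k. c' i = b i"
    using cb by (auto simp: c'_def)
  moreover have "\<forall>i<Suc k. \<forall>j<Suc k. i \<noteq> j \<longrightarrow>
      pairing \<eta> (c' i) (c' j) = 0 \<and> pairing \<eta> (c' i) (\<i> *s c' j) = 0"
    using orth u1 u2 by (auto simp: c'_def less_Suc_eq)
  ultimately show ?case by blast
qed

lemma wedge_pow_frame_pos:
  fixes n :: nat
  assumes \<eta>: "positive_11 \<eta>" and nz: "\<And>i. i < n \<Longrightarrow> c i \<noteq> 0"
    and orth: "\<And>i j. i < n \<Longrightarrow> j < n \<Longrightarrow> i \<noteq> j \<Longrightarrow>
      pairing \<eta> (c i) (c j) = 0 \<and> pairing \<eta> (c i) (\<i> *s c j) = 0"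
  shows "wedge_pow \<eta> n (frame c) > 0"
proof -
  have pos: "(\<Prod>i<n. pairing \<eta> (c (\<pi> i)) (\<i> *s c (\<pi> i))) > 0" if "\<pi> permutes {..<n}" for \<pi>
    using permutes_in_image[OF that] by (intro prod_pos positive_11_pairing[OF \<eta>] nz) auto
  have "{\<pi>. \<pi> permutes {..<n}} \<noteq> {}" using permutes_id by blast
  then have "(\<Sum>\<pi> | \<pi> permutes {..<n}. \<Prod>i<n. pairing \<eta> (c (\<pi> i)) (\<i> *s c (\<pi> i))) > 0"
    using pos by (intro sum_pos finite_permutations) auto
  moreover have "wedge_pow \<eta> n (frame c) = real (card (block_flips n)) / 2 ^ n *
      (\<Sum>\<pi> | \<pi> permutes {..<n}. \<Prod>i<n. pairing \<eta> (c (\<pi> i)) (\<i> *s c (\<pi> i)))"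
    unfolding wedge_pow_eq_mixed
    \<comment> \<open>All factors are diagonal here, so any slot may serve as the exceptional
      one.\<close>
    by (rule mixed_frame[where s = 0]) (use positive_11_real_pp_form[OF \<eta>] orth in auto)
  ultimately show ?thesis using card_block_flips[of n] by simp
qed

lemma positive_top_wedge_pow:
  fixes \<eta> :: "'n::finite form"
  assumes \<eta>: "positive_11 \<eta>"
  shows "positive_top (wedge_pow \<eta> CARD('n))"
  unfolding positive_top_def
proof (intro allI impI)
  fix b :: "nat \<Rightarrow> complex ^ 'n"
  assume "inj_on b {..<CARD('n)} \<and> vec.independent (b ` {..<CARD('n)})"
  moreover have "alternating_form (2 * CARD('n)) (wedge_pow \<eta> CARD('n))"
    using real_pp_form_wedge_pow[OF positive_11_real_pp_form[OF \<eta>]] by (simp add: real_pp_form_def)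
  ultimately obtain c where c: "\<And>i. i < CARD('n) \<Longrightarrow> c i \<noteq> 0"
    "\<And>i j. i < CARD('n) \<Longrightarrow> j < CARD('n) \<Longrightarrow> i \<noteq> j \<Longrightarrow>
      pairing \<eta> (c i) (c j) = 0 \<and> pairing \<eta> (c i) (\<i> *s c j) = 0"
    and eq: "wedge_pow \<eta> CARD('n) (frame c) = wedge_pow \<eta> CARD('n) (frame b)"
    using gram_schmidt_frame[OF \<eta>, of "CARD('n)" _ b "CARD('n)"] by (metis order_refl)
  have "wedge_pow \<eta> CARD('n) (frame b) > 0"
    using wedge_pow_frame_pos[where c = c and n = "CARD('n)", OF \<eta> c] eq by simp
  then show "wedge_pow \<eta> CARD('n) (\<lambda>i. if even i then b (i div 2) else \<i> *s b (i div 2)) > 0"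
    by (simp add: frame_def)
qed

section \<open>Frames adapted to a covector\<close>

text \<open>Each functional is the inner product with its Riesz vector \<open>r f\<close>; too few
  of these to span leave a nonzero orthogonal vector.\<close>

lemma common_kernel_vector:
  fixes F :: "('v::euclidean_space \<Rightarrow> real) set"
  assumes fin: "finite F" and lin: "\<And>f. f \<in> F \<Longrightarrow> linear f" and card: "card F < DIM('v)"
  shows "\<exists>u. u \<noteq> 0 \<and> (\<forall>f\<in>F. f u = 0)"
proof -
  define r where "r = (\<lambda>f :: 'v \<Rightarrow> real. \<Sum>b\<in>Basis. f b *\<^sub>R b)"
  have "dim (r ` F) \<le> card (r ` F)" using fin by (intro dim_le_card') simp
  also have "\<dots> \<le> card F" by (rule card_image_le[OF fin])
  finally have "dim (r ` F) < DIM('v)" using card by simp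
  then obtain u where u: "u \<noteq> 0" "\<And>y. y \<in> span (r ` F) \<Longrightarrow> orthogonal u y"
    using orthogonal_to_subspace_exists by blast
  have "f u = 0" if f: "f \<in> F" for f
  proof -
    have "f u = f (\<Sum>b\<in>Basis. (u \<bullet> b) *\<^sub>R b)" by (simp add: euclidean_representation)
    also have "\<dots> = u \<bullet> r f"
      by (simp add: linear_sum[OF lin[OF f]] linear_scale[OF lin[OF f]] r_def inner_sum_right mult.commute)
    also have "\<dots> = 0" using u(2)[OF span_base[of "r f"]] f by (simp add: orthogonal_def)
    finally show ?thesis .
  qed
  then show ?thesis using u(1) by blast
qed

text \<open>The next vector is a common zero of real functionals. Orthogonality to \<open>k\<close>
  earlier vectors gives at most \<open>2 * k\<close> conditions, and \<xi> adds two more only for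
  \<open>k < CARD('n) - 1\<close>. In both cases the total is at most
  \<open>2 * CARD('n) - 2\<close>, below the real dimension; at the last index there would be no
  room for \<xi>.\<close>

lemma ex_adapted_frame:
  fixes \<eta> :: "'n::finite form" and \<xi> :: "complex ^ 'n \<Rightarrow> complex"
  assumes \<eta>: "positive_11 \<eta>" and \<xi>: "linear \<xi>" and "k \<le> CARD('n)"
  shows "\<exists>c. (\<forall>i<k. pairing \<eta> (c i) (\<i> *s c i) = 1) \<and> (\<forall>i<k. i < CARD('n) - 1 \<longrightarrow> \<xi> (c i) = 0) \<and>
    (\<forall>i<k. \<forall>j<k. i \<noteq> j \<longrightarrow> pairing \<eta> (c i) (c j) = 0 \<and> pairing \<eta> (c i) (\<i> *s c j) = 0)"
  using \<open>k \<le> CARD('n)\<close>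
proof (induction k)
  case 0
  then show ?case by auto
next
  case (Suc k)
  note \<eta>r = positive_11_real_pp_form[OF \<eta>]
  note linL = linear_pairing_left[OF \<eta>r] and linR = linear_pairing_right[OF \<eta>r]
  obtain c where IH: "\<forall>i<k. pairing \<eta> (c i) (\<i> *s c i) = 1"
    "\<forall>i<k. i < CARD('n) - 1 \<longrightarrow> \<xi> (c i) = 0"
    "\<forall>i<k. \<forall>j<k. i \<noteq> j \<longrightarrow> pairing \<eta> (c i) (c j) = 0 \<and> pairing \<eta> (c i) (\<i> *s c j) = 0"
    using Suc.IH[OF Suc_leD[OF Suc.prems]] by (elim exE conjE) (erule (2) that)
  have c: "\<And>i. i < k \<Longrightarrow> pairing \<eta> (c i) (\<i> *s c i) = 1"
    "\<And>i. i < k \<Longrightarrow> i < CARD('n) - 1 \<Longrightarrow> \<xi> (c i) = 0"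
    and orth: "\<And>i j. i < k \<Longrightarrow> j < k \<Longrightarrow> i \<noteq> j \<Longrightarrow>
      pairing \<eta> (c i) (c j) = 0 \<and> pairing \<eta> (c i) (\<i> *s c j) = 0"
    using IH by simp_all
  define G where "G = (if k < CARD('n) - 1 then {\<lambda>u. Re (\<xi> u), \<lambda>u. Im (\<xi> u)} else {})"
  define F where "F = (\<lambda>l u. pairing \<eta> u (frame c l)) ` {..<2 * k} \<union> G"
  have "card G \<le> (if k < CARD('n) - 1 then 2 else 0)"
    unfolding G_def by (simp add: card_insert_if)
  moreover have "card ((\<lambda>l u. pairing \<eta> u (frame c l)) ` {..<2 * k}) \<le> 2 * k"
    using card_image_le[of "{..<2 * k}"] by (metis card_lessThan finite_lessThan)
  ultimately have "card F < 2 * CARD('n)"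
    using card_Un_le[of "(\<lambda>l u. pairing \<eta> u (frame c l)) ` {..<2 * k}" G] Suc.prems
    by (auto simp: F_def split: if_splits)
  then have "card F < DIM(complex ^ 'n)" by simp
  have "finite F" by (simp add: F_def G_def)
  have linF: "linear f" if f: "f \<in> F" for f
  proof -
    have "linear (\<lambda>u. Re (\<xi> u))" "linear (\<lambda>u. Im (\<xi> u))"
      using linear_compose[OF \<xi> bounded_linear.linear[OF bounded_linear_Re]]
        linear_compose[OF \<xi> bounded_linear.linear[OF bounded_linear_Im]]
      by (simp_all only: o_def)
    note lin = this
    consider l where "f = (\<lambda>u. pairing \<eta> u (frame c l))"
      | "f = (\<lambda>u. Re (\<xi> u))" | "f = (\<lambda>u. Im (\<xi> u))"
      using f unfolding F_def G_def by (auto split: if_splits)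
    then show ?thesis
    proof cases
      case 1
      then show ?thesis by (simp only: linL)
    qed (simp_all only: lin)
  qed
  have "\<exists>u. u \<noteq> 0 \<and> (\<forall>f\<in>F. f u = 0)"
    by (rule common_kernel_vector[OF \<open>finite F\<close> linF \<open>card F < DIM(complex ^ 'n)\<close>])
  then obtain u where u: "u \<noteq> 0" and "\<forall>f\<in>F. f u = 0" by (elim exE conjE)
  then have uF: "\<And>f. f \<in> F \<Longrightarrow> f u = 0" by (elim bspec)
  have uc: "pairing \<eta> u (frame c l) = 0" if "l < 2 * k" for l
  proof (rule uF)
    show "(\<lambda>u. pairing \<eta> u (frame c l)) \<in> F" unfolding F_def using that by blast
  qed
  have u\<xi>: "\<xi> u = 0" if "k < CARD('n) - 1"
  proof -
    have "(\<lambda>u. Re (\<xi> u)) \<in> F" "(\<lambda>u. Im (\<xi> u)) \<in> F" unfolding F_def G_def using that by simp_all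
    from this[THEN uF] show ?thesis by (simp add: complex_eq_iff)
  qed
  define d where "d = pairing \<eta> u (\<i> *s u)"
  have d: "d > 0" unfolding d_def by (rule positive_11_pairing[OF \<eta> u])
  define w where "w = (1 / sqrt d) *\<^sub>R u"
  have iw: "\<i> *s w = (1 / sqrt d) *\<^sub>R (\<i> *s u)"
    unfolding w_def by (rule linear_scale[OF linear_complex_scale])
  have "pairing \<eta> w (\<i> *s w) = 1 / sqrt d * (1 / sqrt d) * d"
    unfolding iw unfolding w_def d_def
    by (simp only: linear_scale[OF linL] linear_scale[OF linR] real_scaleR_def mult.assoc)
  then have w1: "pairing \<eta> w (\<i> *s w) = 1" using d by simp
  have w2: "pairing \<eta> w (c j) = 0" "pairing \<eta> w (\<i> *s c j) = 0" if "j < k" for j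
    using uc[of "2 * j"] uc[of "Suc (2 * j)"] that by (simp_all add: w_def linear_scale[OF linL])
  have w3: "pairing \<eta> (c j) w = 0" "pairing \<eta> (c j) (\<i> *s w) = 0" if "j < k" for j
  proof -
    show "pairing \<eta> (c j) w = 0" using w2[OF that] pairing_commute[OF \<eta>r, of w "c j"] by simp
    show "pairing \<eta> (c j) (\<i> *s w) = 0"
      using w2[OF that] pairing_commute[OF \<eta>r, of "c j" "\<i> *s w"] pairing_ii_left[OF \<eta>r, of w "c j"]
      by simp
  qed
  have w4: "\<xi> w = 0" if "k < CARD('n) - 1"
    using u\<xi>[OF that] by (simp add: w_def linear_scale[OF \<xi>])
  show ?case
  proof (intro exI[of _ "c(k := w)"] conjI)
    show "\<forall>i<Suc k. pairing \<eta> ((c(k := w)) i) (\<i> *s (c(k := w)) i) = 1"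
      using c(1) w1 by (simp add: less_Suc_eq)
    show "\<forall>i<Suc k. i < CARD('n) - 1 \<longrightarrow> \<xi> ((c(k := w)) i) = 0"
      using c(2) w4 by (simp add: less_Suc_eq)
    show "\<forall>i<Suc k. \<forall>j<Suc k. i \<noteq> j \<longrightarrow> pairing \<eta> ((c(k := w)) i) ((c(k := w)) j) = 0 \<and>
        pairing \<eta> ((c(k := w)) i) (\<i> *s (c(k := w)) j) = 0"
      using orth w2 w3 by (auto simp: less_Suc_eq)
  qed
qed

section \<open>The pointwise inequality\<close>

text \<open>Moves a factor from one slot to another, so the sums below do not depend on which slots
  their factors occupy.\<close>

lemma sum_permutations_swap:
  assumes "a < n" "b < n"
  shows "(\<Sum>\<pi> | \<pi> permutes {..<n}. f \<pi>) =
    (\<Sum>\<pi> | \<pi> permutes {..<n::nat}. f (\<pi> \<circ> Transposition.transpose a b))"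
  by (rule sum_permutations_compose_right, rule permutes_swap_id) (use assms in auto)

text \<open>Traces appear by averaging over slots. The sum in the hypothesis is
  \<open>fact (n - 1)\<close> times the trace of \<mu>, which gives \<open>r * tr \<le> n\<close>;
  the factor \<open>n - 1\<close> in the conclusion counts the slots other than the last, whose
  entries of \<mu> add up to the trace without the last one. The claim then holds permutation by
  permutation, strictly where \<open>j0\<close> comes last.\<close>

lemma sum_permutations_trace_le:
  fixes \<mu> x :: "nat \<Rightarrow> real" and r :: real and n :: nat
  assumes n: "n \<ge> 2" and \<mu>: "\<And>j. j < n \<Longrightarrow> \<mu> j > 0"
    and x: "\<And>j. j < n \<Longrightarrow> x j \<ge> 0" and j0: "j0 < n" "x j0 > 0"
    and r: "r > 0" "r * (\<Sum>\<pi> | \<pi> permutes {..<n}. \<mu> (\<pi> (n - 1))) \<le> fact n"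
  shows "real (n - 1) * r * (\<Sum>\<pi> | \<pi> permutes {..<n}. \<mu> (\<pi> (n - 2)) * x (\<pi> (n - 1)))
       < real n * (\<Sum>\<pi> | \<pi> permutes {..<n}. x (\<pi> (n - 1)))"
proof -
  let ?P = "{\<pi>. \<pi> permutes {..<n}}" and ?t = Transposition.transpose
  define tr where "tr = (\<Sum>j<n. \<mu> j)"
  have sum_perm: "(\<Sum>k<n. \<mu> (\<pi> k)) = tr" if "\<pi> \<in> ?P" for \<pi>
    unfolding tr_def using sum.permute[of \<pi> "{..<n}" \<mu>] that by (simp add: o_def)
  have swap1: "(\<Sum>\<pi>\<in>?P. \<mu> (\<pi> k)) = (\<Sum>\<pi>\<in>?P. \<mu> (\<pi> (n - 1)))" if "k < n" for k
    using sum_permutations_swap[of k n "n - 1" "\<lambda>\<pi>. \<mu> (\<pi> k)"] that n by simp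
  have "(\<Sum>k<n. \<Sum>\<pi>\<in>?P. \<mu> (\<pi> k)) = (\<Sum>k<n. \<Sum>\<pi>\<in>?P. \<mu> (\<pi> (n - 1)))"
  proof (rule sum.cong[OF refl])
    show "(\<Sum>\<pi>\<in>?P. \<mu> (\<pi> k)) = (\<Sum>\<pi>\<in>?P. \<mu> (\<pi> (n - 1)))" if "k \<in> {..<n}" for k
      using swap1[of k] that by blast
  qed
  \<comment> \<open>Interchanging the sums makes the inner one the full trace for every
    permutation.\<close>
  then have "real n * (\<Sum>\<pi>\<in>?P. \<mu> (\<pi> (n - 1))) = (\<Sum>k<n. \<Sum>\<pi>\<in>?P. \<mu> (\<pi> k))" by simp
  also have "\<dots> = (\<Sum>\<pi>\<in>?P. \<Sum>k<n. \<mu> (\<pi> k))" by (rule sum.swap)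
  also have "\<dots> = fact n * tr" using sum_perm by (simp add: card_permutations[of _ n])
  finally have "r * (real n * (\<Sum>\<pi>\<in>?P. \<mu> (\<pi> (n - 1)))) = r * (fact n * tr)" by (rule arg_cong)
  then have "real n * (r * (\<Sum>\<pi>\<in>?P. \<mu> (\<pi> (n - 1)))) = fact n * (r * tr)"
    by (simp only: mult.left_commute)
  moreover have "real n * (r * (\<Sum>\<pi>\<in>?P. \<mu> (\<pi> (n - 1)))) \<le> real n * fact n"
    using r(2) by (rule mult_left_mono) simp
  ultimately have "fact n * (r * tr) \<le> fact n * real n" by (simp only: mult.commute)
  then have rtr: "r * tr \<le> real n" by (simp only: mult_le_cancel_left_pos[OF fact_gt_zero])
  have swap2: "(\<Sum>\<pi>\<in>?P. \<mu> (\<pi> k) * x (\<pi> (n - 1))) = (\<Sum>\<pi>\<in>?P. \<mu> (\<pi> (n - 2)) * x (\<pi> (n - 1)))"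
    if "k < n - 1" for k
  proof -
    have "?t k (n - 2) (n - 1) = n - 1" using that n by (intro transpose_apply_other) auto
    then show ?thesis
      using sum_permutations_swap[of k n "n - 2" "\<lambda>\<pi>. \<mu> (\<pi> k) * x (\<pi> (n - 1))"] that n by simp
  qed
  have "(\<Sum>k<n - 1. \<Sum>\<pi>\<in>?P. \<mu> (\<pi> k) * x (\<pi> (n - 1)))
      = (\<Sum>k<n - 1. \<Sum>\<pi>\<in>?P. \<mu> (\<pi> (n - 2)) * x (\<pi> (n - 1)))"
  proof (rule sum.cong[OF refl])
    show "(\<Sum>\<pi>\<in>?P. \<mu> (\<pi> k) * x (\<pi> (n - 1))) = (\<Sum>\<pi>\<in>?P. \<mu> (\<pi> (n - 2)) * x (\<pi> (n - 1)))"
      if "k \<in> {..<n - 1}" for k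
      using swap2[of k] that by blast
  qed
  then have "real (n - 1) * (\<Sum>\<pi>\<in>?P. \<mu> (\<pi> (n - 2)) * x (\<pi> (n - 1)))
      = (\<Sum>k<n - 1. \<Sum>\<pi>\<in>?P. \<mu> (\<pi> k) * x (\<pi> (n - 1)))"
    by simp
  also have "\<dots> = (\<Sum>\<pi>\<in>?P. (\<Sum>k<n - 1. \<mu> (\<pi> k)) * x (\<pi> (n - 1)))"
    by (subst sum.swap) (simp add: sum_distrib_right)
  also have "\<dots> = (\<Sum>\<pi>\<in>?P. (tr - \<mu> (\<pi> (n - 1))) * x (\<pi> (n - 1)))"
  proof (rule sum.cong[OF refl])
    fix \<pi> assume \<pi>: "\<pi> \<in> ?P"
    obtain m where m: "n = Suc m" using n by (cases n) auto
    show "(\<Sum>k<n - 1. \<mu> (\<pi> k)) * x (\<pi> (n - 1)) = (tr - \<mu> (\<pi> (n - 1))) * x (\<pi> (n - 1))"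
      using sum_perm[OF \<pi>] by (simp add: m)
  qed
  finally have "r * (real (n - 1) * (\<Sum>\<pi>\<in>?P. \<mu> (\<pi> (n - 2)) * x (\<pi> (n - 1))))
      = r * (\<Sum>\<pi>\<in>?P. (tr - \<mu> (\<pi> (n - 1))) * x (\<pi> (n - 1)))" by (rule arg_cong)
  then have eq: "real (n - 1) * r * (\<Sum>\<pi>\<in>?P. \<mu> (\<pi> (n - 2)) * x (\<pi> (n - 1)))
      = (\<Sum>\<pi>\<in>?P. r * ((tr - \<mu> (\<pi> (n - 1))) * x (\<pi> (n - 1))))"
    unfolding sum_distrib_left[of r, symmetric] by (simp only: mult_ac)
  have le: "r * ((tr - \<mu> j) * x j) \<le> real n * x j" and less: "x j > 0 \<Longrightarrow> r * ((tr - \<mu> j) * x j) < real n * x j"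
    if "j < n" for j
  proof -
    \<comment> \<open>The removed term \<open>r * \<mu> j\<close> is positive, which makes the weak
      trace bound strict.\<close>
    have "r * (tr - \<mu> j) < real n"
      using rtr mult_pos_pos[OF r(1) \<mu>[OF that]] by (simp add: right_diff_distrib)
    then show "r * ((tr - \<mu> j) * x j) \<le> real n * x j" "x j > 0 \<Longrightarrow> r * ((tr - \<mu> j) * x j) < real n * x j"
      using x[OF that] by (simp_all add: mult_right_mono flip: mult.assoc)
  qed
  have "(\<Sum>\<pi>\<in>?P. r * ((tr - \<mu> (\<pi> (n - 1))) * x (\<pi> (n - 1)))) < (\<Sum>\<pi>\<in>?P. real n * x (\<pi> (n - 1)))"
  proof (rule sum_strict_mono_ex1)
    show "finite ?P" by (simp add: finite_permutations)
    show "\<forall>\<pi>\<in>?P. r * ((tr - \<mu> (\<pi> (n - 1))) * x (\<pi> (n - 1))) \<le> real n * x (\<pi> (n - 1))"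
    proof
      fix \<pi> assume "\<pi> \<in> ?P"
      then have "\<pi> (n - 1) < n" using permutes_in_image[of \<pi> "{..<n}" "n - 1"] n by simp
      then show "r * ((tr - \<mu> (\<pi> (n - 1))) * x (\<pi> (n - 1))) \<le> real n * x (\<pi> (n - 1))" by (rule le)
    qed
    \<comment> \<open>A permutation that carries the last slot to \<open>j0\<close>, where
      strictness is available.\<close>
    have "?t j0 (n - 1) \<in> ?P" using j0 n by (auto intro: permutes_swap_id)
    moreover have "r * ((tr - \<mu> (?t j0 (n - 1) (n - 1))) * x (?t j0 (n - 1) (n - 1)))
        < real n * x (?t j0 (n - 1) (n - 1))"
      unfolding transpose_apply_second by (rule less[OF j0])
    ultimately show "\<exists>\<pi>\<in>?P. r * ((tr - \<mu> (\<pi> (n - 1))) * x (\<pi> (n - 1))) < real n * x (\<pi> (n - 1))"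
      by blast
  qed
  then show ?thesis unfolding eq sum_distrib_left[of "real n"] .
qed

section \<open>The rank-one form of a covector\<close>

lemma pairing_i_wedge_cnj_ii:
  assumes "Vector_Spaces.linear (*s) (*) \<xi>"
  shows "pairing (i_wedge_cnj \<xi>) u (\<i> *s u) = 2 * (cmod (\<xi> u))\<^sup>2"
proof -
  have "\<xi> (\<i> *s u) = \<i> * \<xi> u"
    using assms by (simp add: Vector_Spaces.linear_iff)
  then show ?thesis
    by (simp add: pairing_def i_wedge_cnj_def cmod_power2 flip: power2_eq_square)
qed

lemma linear_if_complex_linear:
  fixes \<xi> :: "complex ^ 'n \<Rightarrow> complex"
  assumes "Vector_Spaces.linear (*s) (*) \<xi>"
  shows "linear \<xi>"
proof (rule linearI)
  have *: "\<xi> (x + y) = \<xi> x + \<xi> y" "\<xi> (z *s x) = z * \<xi> x" for x y z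
    using assms by (simp_all add: Vector_Spaces.linear_iff)
  show "\<xi> (x + y) = \<xi> x + \<xi> y" for x y by (rule *)
  show "\<xi> (r *\<^sub>R x) = r *\<^sub>R \<xi> x" for r x
  proof -
    have "r *\<^sub>R x = complex_of_real r *s x"
      by (simp add: vec_eq_iff scaleR_conv_of_real[where 'a = complex])
    then show ?thesis by (simp add: * scaleR_conv_of_real)
  qed
qed

lemma real_pp_form_i_wedge_cnj:
  assumes \<xi>: "Vector_Spaces.linear (*s) (*) \<xi>"
  shows "real_pp_form 1 (i_wedge_cnj \<xi>)"
  unfolding real_pp_form_def alternating_form_def
proof (intro conjI allI impI)
  fix v w :: "nat \<Rightarrow> complex ^ 'a" assume "\<forall>i<2 * 1. v i = w i"
  then show "i_wedge_cnj \<xi> v = i_wedge_cnj \<xi> w" by (simp add: i_wedge_cnj_def)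
next
  fix v :: "nat \<Rightarrow> complex ^ 'a" and i :: nat assume "i < 2 * 1"
  then have i: "i = 0 \<or> i = 1" by auto
  note L = linear_if_complex_linear[OF \<xi>]
  show "linear (\<lambda>x. i_wedge_cnj \<xi> (v(i := x)))"
    using i by (intro linearI; elim disjE)
      (simp_all add: i_wedge_cnj_def linear_add[OF L] linear_scale[OF L] algebra_simps)
next
  fix v :: "nat \<Rightarrow> complex ^ 'a" and i j :: nat
  assume "i < 2 * 1" "j < 2 * 1" "i \<noteq> j \<and> v i = v j"
  then have "v 0 = v 1" by (auto simp: less_2_cases_iff)
  then show "i_wedge_cnj \<xi> v = 0" by (simp add: i_wedge_cnj_def)
next
  fix c :: complex and v :: "nat \<Rightarrow> complex ^ 'a" assume c: "cmod c = 1"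
  have \<xi>c: "\<xi> (c *s x) = c * \<xi> x" for x
    using \<xi> by (simp add: Vector_Spaces.linear_iff)
  have "c * cnj c = 1" using c by (simp add: complex_norm_square[symmetric])
  then have "(c * a) * cnj (c * b) = a * cnj b" for a b
    by (simp add: mult_ac flip: mult.assoc)
  then show "i_wedge_cnj \<xi> (\<lambda>i. c *s v i) = i_wedge_cnj \<xi> v"
    by (simp only: i_wedge_cnj_def \<xi>c)
qed

text \<open>The whole theorem at one point, with \<open>r\<close> for the exponential. The
  hypothesis stays logarithmic because that is what \<open>Q_op\<close> delivers.\<close>

lemma codeg1_less_wedge_pow:
  fixes \<omega> \<eta> :: "'n::finite form" and r :: real
  assumes n: "CARD('n) \<ge> 2" and \<eta>: "positive_11 \<eta>" and \<omega>: "positive_11 \<omega>" and r: "r > 0"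
    and q: "ln r \<le> ln (top_quotient (wedge_pow \<eta> CARD('n))
      (wedge 2 (2 * (CARD('n) - 1)) \<omega> (wedge_pow \<eta> (CARD('n) - 1))))"
  shows "codeg1_less
    (\<lambda>v. real (CARD('n) - 1) * r * wedge (2 * (CARD('n) - 2)) 2 (wedge_pow \<eta> (CARD('n) - 2)) \<omega> v)
    (\<lambda>v. real CARD('n) * wedge_pow \<eta> (CARD('n) - 1) v)"
proof -
  note \<eta>r = positive_11_real_pp_form[OF \<eta>] and \<omega>r = positive_11_real_pp_form[OF \<omega>]
  obtain m where m: "CARD('n) = Suc (Suc m)"
    using n by (metis add_2_eq_Suc le_Suc_ex)
  have nm: "CARD('n) - 1 = Suc m" "CARD('n) - 2 = m" using m by auto
  define N where "N = CARD('n)"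
  define S where "S = (\<lambda>f. \<Sum>\<pi> | \<pi> permutes {..<N}. (f \<pi> :: real))"
  define K where "K = real (card (block_flips N)) / 2 ^ N"
  have K: "K > 0" using card_block_flips[of N] by (simp add: K_def)
  define \<Phi> where "\<Phi> = wedge (2 * m) 2 (wedge_pow \<eta> m) \<omega>"
  define \<Psi> where "\<Psi> = wedge_pow \<eta> (Suc m)"
  define \<Theta> where "\<Theta> = (\<lambda>v. real N * \<Psi> v - real (Suc m) * r * \<Phi> v)"
  have \<Psi>r: "real_pp_form (Suc m) \<Psi>" unfolding \<Psi>_def by (rule real_pp_form_wedge_pow[OF \<eta>r])
  have \<Phi>r: "real_pp_form (Suc m) \<Phi>"
    using real_pp_form_wedge[OF real_pp_form_wedge_pow[OF \<eta>r, of m] \<omega>r] by (simp add: \<Phi>_def)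
  have \<Theta>r: "real_pp_form (Suc m) \<Theta>"
    unfolding \<Theta>_def by (rule real_pp_form_combination[OF \<Psi>r \<Phi>r])
  have top: "alternating_form (2 * CARD('n)) (wedge (2 * Suc m) 2 \<Upsilon> \<zeta>)"
    if "real_pp_form (Suc m) \<Upsilon>" "real_pp_form 1 \<zeta>" for \<Upsilon> \<zeta> :: "'n form"
    using real_pp_form_wedge[OF that] by (simp add: real_pp_form_def m)
  \<comment> \<open>The factor \<omega> sits in slot \<open>m\<close>; slot \<open>Suc m\<close>,
    the last of the \<open>n\<close>, is kept for the form of \<xi>.\<close>
  have \<Phi>_mixed: "\<Phi> = mixed (Suc m) (\<lambda>i. if i = m then \<omega> else \<eta>)"
  proof -
    have "\<Phi> = wedge (2 * m) 2 (mixed m (\<lambda>i. if i = m then \<omega> else \<eta>)) \<omega>"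
      unfolding \<Phi>_def wedge_pow_eq_mixed by (subst mixed_cong[of m]) auto
    then show ?thesis using wedge_mixed[of m "\<lambda>i. if i = m then \<omega> else \<eta>"] by simp
  qed
  have \<Psi>_mixed: "\<Psi> = mixed (Suc m) (\<lambda>_. \<eta>)"
    unfolding \<Psi>_def by (rule wedge_pow_eq_mixed)
  have wedge_last: "wedge (2 * Suc m) 2 (mixed (Suc m) \<alpha>) \<zeta> = mixed N (\<alpha>(Suc m := \<zeta>))"
    for \<alpha> and \<zeta> :: "'n form"
  proof -
    have "mixed (Suc m) \<alpha> = mixed (Suc m) (\<alpha>(Suc m := \<zeta>))" by (rule mixed_cong) auto
    then show ?thesis using wedge_mixed[of "Suc m" "\<alpha>(Suc m := \<zeta>)"] by (simp add: N_def m)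
  qed
  define \<beta> where "\<beta> = wedge 2 (2 * Suc m) \<omega> \<Psi>"
  have \<beta>_eq: "\<beta> = wedge (2 * Suc m) 2 \<Psi> \<omega>"
    unfolding \<beta>_def
    by (rule wedge_2_commute) (use \<omega>r \<Psi>r in \<open>simp_all add: real_pp_form_def\<close>)
  have \<eta>top: "alternating_form (2 * CARD('n)) (wedge_pow \<eta> N)"
    using real_pp_form_wedge_pow[OF \<eta>r, of N] by (simp add: real_pp_form_def N_def)
  have "positive_top (wedge (2 * Suc m) 2 \<Theta> (i_wedge_cnj \<xi>))"
    if \<xi>: "Vector_Spaces.linear (*s) (*) \<xi>" and \<xi>0: "\<xi> \<noteq> (\<lambda>_. 0)" for \<xi> :: "complex ^ 'n \<Rightarrow> complex"
  proof -
    define \<zeta> where "\<zeta> = i_wedge_cnj \<xi>"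
    note \<xi>lin = linear_if_complex_linear[OF \<xi>]
    have \<zeta>r: "real_pp_form 1 \<zeta>" unfolding \<zeta>_def by (rule real_pp_form_i_wedge_cnj[OF \<xi>])
    obtain c where c: "\<forall>i<N. pairing \<eta> (c i) (\<i> *s c i) = 1" "\<forall>i<N. i < N - 1 \<longrightarrow> \<xi> (c i) = 0"
      and orth: "\<forall>i<N. \<forall>j<N. i \<noteq> j \<longrightarrow> pairing \<eta> (c i) (c j) = 0 \<and> pairing \<eta> (c i) (\<i> *s c j) = 0"
      using ex_adapted_frame[OF \<eta> \<xi>lin order_refl, folded N_def] by (elim exE conjE) (erule (2) that)
    have c0: "c i \<noteq> 0" if "i < N" for i
    proof
      assume "c i = 0"
      then have "pairing \<eta> (c i) (\<i> *s c i) = 0"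
        using linear_0[OF linear_pairing_left[OF \<eta>r]] by simp
      then show False using c(1) that by simp
    qed
    define \<mu> where "\<mu> = (\<lambda>j. pairing \<omega> (c j) (\<i> *s c j))"
    define x where "x = (\<lambda>j. pairing \<zeta> (c j) (\<i> *s c j))"
    have \<mu>: "\<mu> j > 0" if "j < N" for j
      unfolding \<mu>_def by (rule positive_11_pairing[OF \<omega> c0[OF that]])
    have x_eq: "x j = 2 * (cmod (\<xi> (c j)))\<^sup>2" for j
      unfolding x_def \<zeta>_def by (rule pairing_i_wedge_cnj_ii[OF \<xi>])
    \<comment> \<open>Of two distinct indices at least one is not the last, and there \<xi>
      vanishes.\<close>
    have \<zeta>off: "pairing \<zeta> (c j) (c k) = 0 \<and> pairing \<zeta> (c j) (\<i> *s c k) = 0"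
      if jk: "j < N" "k < N" "j \<noteq> k" for j k
    proof -
      have "\<xi> (c j) = 0 \<or> \<xi> (c k) = 0" using c(2) jk by (cases "j < N - 1") auto
      moreover have "\<xi> (\<i> *s u) = \<i> * \<xi> u" for u
        using \<xi> by (simp add: Vector_Spaces.linear_iff)
      ultimately show ?thesis by (auto simp: pairing_def \<zeta>_def i_wedge_cnj_def)
    qed
    have eval: "mixed N \<alpha> (frame c) = K * S (\<lambda>\<pi>. \<Prod>i<N. pairing (\<alpha> i) (c (\<pi> i)) (\<i> *s c (\<pi> i)))"
      if \<alpha>: "\<And>i. i < N \<Longrightarrow> \<alpha> i = \<eta> \<or> \<alpha> i = \<zeta> \<or> (i = s \<and> \<alpha> i = \<omega>)" for \<alpha> s
      unfolding K_def S_def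
    proof (rule mixed_frame[where s = s])
      show "real_pp_form 1 (\<alpha> i)" if "i < N" for i
        using \<alpha>[OF that] \<eta>r \<omega>r \<zeta>r by auto
      show "pairing (\<alpha> i) (c j) (c k) = 0 \<and> pairing (\<alpha> i) (c j) (\<i> *s c k) = 0"
        if "i < N" "i \<noteq> s" "j < N" "k < N" "j \<noteq> k" for i j k
        using \<alpha>[OF that(1)] that orth \<zeta>off[OF that(3-5)] by auto
    qed
    have perm: "\<pi> i < N" if "\<pi> permutes {..<N}" "i < N" for \<pi> i
      using permutes_in_image[OF that(1), of i] that(2) by simp
    have N: "N = Suc (Suc m)" by (simp add: N_def m)
    have one: "pairing \<eta> (c (\<pi> i)) (\<i> *s c (\<pi> i)) = 1" if "\<pi> permutes {..<N}" "i < N" for \<pi> i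
      using c(1) perm[OF that] by blast
    have prod_one: "(\<Prod>i<m. pairing \<eta> (c (\<pi> i)) (\<i> *s c (\<pi> i))) = 1" if "\<pi> permutes {..<N}" for \<pi>
      using one[OF that] N by (intro prod.neutral) simp
    have S_cong: "S f = S g" if "\<And>\<pi>. \<pi> permutes {..<N} \<Longrightarrow> f \<pi> = g \<pi>" for f g
      unfolding S_def by (rule sum.cong) (use that in auto)
    \<comment> \<open>The first \<open>m\<close> factors equal 1 on a unitary frame, so only the
      last two slots survive.\<close>
    have prods: "(\<Prod>i<N. pairing (\<alpha> i) (c (\<pi> i)) (\<i> *s c (\<pi> i))) =
        pairing (\<alpha> m) (c (\<pi> m)) (\<i> *s c (\<pi> m)) *
        pairing (\<alpha> (Suc m)) (c (\<pi> (Suc m))) (\<i> *s c (\<pi> (Suc m)))"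
      if "\<pi> permutes {..<N}" "\<And>i. i < m \<Longrightarrow> \<alpha> i = \<eta>" for \<pi> \<alpha>
    proof -
      have "(\<Prod>i<m. pairing (\<alpha> i) (c (\<pi> i)) (\<i> *s c (\<pi> i))) = 1"
        using prod_one[OF that(1)] that(2) by simp
      then show ?thesis by (simp add: N)
    qed
    have v\<eta>: "wedge_pow \<eta> N (frame c) = K * fact N"
    proof -
      have "wedge_pow \<eta> N (frame c) = K * S (\<lambda>\<pi>. 1)"
        unfolding wedge_pow_eq_mixed
        by (subst eval, blast, rule arg_cong[where f = "(*) K"], rule S_cong, subst prods)
          (use one N in auto)
      then show ?thesis by (simp add: S_def card_permutations[of _ N])
    qed
    have v\<omega>: "\<beta> (frame c) = K * S (\<lambda>\<pi>. \<mu> (\<pi> (N - 1)))"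
      unfolding \<beta>_eq \<Psi>_mixed wedge_last
      by (subst eval[where s = "Suc m"], simp, rule arg_cong[where f = "(*) K"], rule S_cong, subst prods)
        (use one N in \<open>auto simp: \<mu>_def\<close>)
    have v\<eta>\<zeta>: "wedge (2 * Suc m) 2 \<Psi> \<zeta> (frame c) = K * S (\<lambda>\<pi>. x (\<pi> (N - 1)))"
      unfolding \<Psi>_mixed wedge_last
      by (subst eval, simp, rule arg_cong[where f = "(*) K"], rule S_cong, subst prods)
        (use one N in \<open>auto simp: x_def\<close>)
    have v\<omega>\<zeta>: "wedge (2 * Suc m) 2 \<Phi> \<zeta> (frame c) = K * S (\<lambda>\<pi>. \<mu> (\<pi> (N - 2)) * x (\<pi> (N - 1)))"
      unfolding \<Phi>_mixed wedge_last
      by (subst eval[where s = m], simp, rule arg_cong[where f = "(*) K"], rule S_cong, subst prods)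
        (use N in \<open>auto simp: x_def \<mu>_def\<close>)
    have S\<mu>: "S (\<lambda>\<pi>. \<mu> (\<pi> (N - 1))) > 0"
      unfolding S_def
    proof (rule sum_pos)
      show "{\<pi>. \<pi> permutes {..<N}} \<noteq> {}" using permutes_id by blast
      show "0 < \<mu> (\<pi> (N - 1))" if "\<pi> \<in> {\<pi>. \<pi> permutes {..<N}}" for \<pi>
        using that perm[of \<pi> "N - 1"] N by (intro \<mu>) simp
    qed (simp add: finite_permutations)
    have \<eta>pos: "wedge_pow \<eta> N (frame c) > 0" unfolding v\<eta> using K by simp
    \<comment> \<open>Here \<open>S\<close> over the last slot is \<open>fact (N - 1)\<close> times
      the trace of \<omega>, so the quotient is \<open>N\<close> divided by that trace.\<close>
    have "top_quotient (wedge_pow \<eta> N) \<beta> = wedge_pow \<eta> N (frame c) / \<beta> (frame c)"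
    proof (rule top_quotient_eq[OF \<eta>top])
      show "alternating_form (2 * CARD('n)) \<beta>"
        unfolding \<beta>_eq by (rule top[OF \<Psi>r \<omega>r])
      show "\<beta> (frame c) \<noteq> 0" unfolding v\<omega> using K S\<mu> by simp
    qed
    also have "\<dots> = fact N / S (\<lambda>\<pi>. \<mu> (\<pi> (N - 1)))"
      unfolding v\<eta> v\<omega> using K by simp
    finally have "ln r \<le> ln (fact N / S (\<lambda>\<pi>. \<mu> (\<pi> (N - 1))))"
      using q unfolding \<beta>_def \<Psi>_def nm N_def by simp
    \<comment> \<open>Removing \<open>ln\<close> on both sides requires positive arguments.\<close>
    moreover have "fact N / S (\<lambda>\<pi>. \<mu> (\<pi> (N - 1))) > 0" using S\<mu> by simp
    ultimately have "r \<le> fact N / S (\<lambda>\<pi>. \<mu> (\<pi> (N - 1)))"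
      using r ln_le_cancel_iff by blast
    then have rS: "r * S (\<lambda>\<pi>. \<mu> (\<pi> (N - 1))) \<le> fact N"
      using S\<mu> by (simp add: pos_le_divide_eq)
    \<comment> \<open>Otherwise \<xi> would vanish on the whole frame, which spans because \<eta>
      has nonzero top power there.\<close>
    have "\<xi> (c (N - 1)) \<noteq> 0"
    proof
      assume "\<xi> (c (N - 1)) = 0"
      then have ci: "\<xi> (c i) = 0" if "i < N" for i
        using c(2) that by (cases "i < N - 1") (auto simp: less_Suc_eq N)
      have z: "\<xi> w = 0" if "w \<in> frame c ` {..<2 * N}" for w
      proof -
        have "\<xi> (\<i> *s u) = \<i> * \<xi> u" for u
          using \<xi> by (simp add: Vector_Spaces.linear_iff)
        then show ?thesis using that ci by (auto simp: frame_def)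
      qed
      have "span (frame c ` {..<2 * N}) = UNIV"
        using alternating_form_nonzero_imp_spanning[OF \<eta>top, of "frame c"] \<eta>pos by (simp add: N_def)
      then have "\<xi> w = 0" for w
        using linear_eq_0_on_span[OF \<xi>lin, of "frame c ` {..<2 * N}" w] z by blast
      then show False using \<xi>0 by auto
    qed
    then have xpos: "x (N - 1) > 0" by (simp add: x_eq)
    have "real (N - 1) * r * S (\<lambda>\<pi>. \<mu> (\<pi> (N - 2)) * x (\<pi> (N - 1))) < real N * S (\<lambda>\<pi>. x (\<pi> (N - 1)))"
      unfolding S_def
    proof (rule sum_permutations_trace_le)
      show "x j \<ge> 0" for j by (simp add: x_eq)
      show "r * (\<Sum>\<pi> | \<pi> permutes {..<N}. \<mu> (\<pi> (N - 1))) \<le> fact N" using rS by (simp only: S_def)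
    qed (use \<mu> xpos r N in auto)
    then have "K * (real (N - 1) * r * S (\<lambda>\<pi>. \<mu> (\<pi> (N - 2)) * x (\<pi> (N - 1))))
        < K * (real N * S (\<lambda>\<pi>. x (\<pi> (N - 1))))"
      using K by (rule mult_strict_left_mono)
    then have \<Theta>pos: "wedge (2 * Suc m) 2 \<Theta> \<zeta> (frame c) > 0"
      unfolding \<Theta>_def wedge_combination v\<eta>\<zeta> v\<omega>\<zeta> by (simp add: N mult_ac)
    show ?thesis
      unfolding positive_top_def \<zeta>_def[symmetric]
    proof (intro allI impI)
      fix b :: "nat \<Rightarrow> complex ^ 'n"
      let ?b = "\<lambda>i. if even i then b (i div 2) else \<i> *s b (i div 2)"
      assume "inj_on b {..<CARD('n)} \<and> vec.independent (b ` {..<CARD('n)})"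
      then have "wedge_pow \<eta> N ?b > 0"
        using positive_top_wedge_pow[OF \<eta>] unfolding positive_top_def N_def by blast
      \<comment> \<open>Carries the sign found on the adapted frame over to an arbitrary complex
        basis.\<close>
      moreover have "wedge (2 * Suc m) 2 \<Theta> \<zeta> ?b =
          wedge (2 * Suc m) 2 \<Theta> \<zeta> (frame c) / wedge_pow \<eta> N (frame c) * wedge_pow \<eta> N ?b"
        by (rule top_form_unique[OF top[OF \<Theta>r \<zeta>r] \<eta>top]) (use \<eta>pos in simp)
      ultimately show "wedge (2 * Suc m) 2 \<Theta> \<zeta> ?b > 0"
        using \<Theta>pos \<eta>pos by simp
    qed
  qed
  then have "strictly_positive_codeg1 \<Theta>"
    unfolding strictly_positive_codeg1_def nm using \<Theta>r by blast
  then show ?thesis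
    unfolding codeg1_less_def nm \<Theta>_def \<Psi>_def \<Phi>_def N_def .
qed

theorem lemma4p1:
  fixes X :: "'a topology" and A :: "('a, 'n::finite) chart set"
    and \<omega> chi :: "('a, 'n) form_field"
    and F \<phi> :: "'a \<Rightarrow> real" and lam :: real
  assumes "complex_manifold X A" and "compact_space X" and "connected_space X"
    and "CARD('n) \<ge> 2"
    and "hermitian_metric X A \<omega>" and "hermitian_metric X A chi"
    and "smooth_fun A F"
    and "\<phi> \<in> potentials X A chi"
    and "\<forall>p\<in>topspace X. Q_op A \<omega> chi F \<phi> p \<ge> lam"
  shows "(\<forall>p\<in>topspace X. codeg1_less
            (\<lambda>v. real (CARD('n) - 1) * exp (lam - F p) *
                  wedge (2 * (CARD('n) - 2)) 2
                    (wedge_pow (deform A chi \<phi> p) (CARD('n) - 2)) (\<omega> p) v)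
            (\<lambda>v. real CARD('n) * wedge_pow (deform A chi \<phi> p) (CARD('n) - 1) v))
       \<and> ddbar_class A chi \<in> cone_C1 X \<omega> (\<lambda>p. F p - lam)"
proof
  have \<phi>: "smooth_fun A \<phi>" and pos: "\<forall>p\<in>topspace X. positive_11 (deform A chi \<phi> p)"
    using assms(8) by (auto simp: potentials_def)
  show main: "\<forall>p\<in>topspace X. codeg1_less
            (\<lambda>v. real (CARD('n) - 1) * exp (lam - F p) *
                  wedge (2 * (CARD('n) - 2)) 2
                    (wedge_pow (deform A chi \<phi> p) (CARD('n) - 2)) (\<omega> p) v)
            (\<lambda>v. real CARD('n) * wedge_pow (deform A chi \<phi> p) (CARD('n) - 1) v)"
  proof
    fix p assume p: "p \<in> topspace X"
    have \<eta>: "positive_11 (deform A chi \<phi> p)" using pos p by blast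
    have \<omega>: "positive_11 (\<omega> p)" using assms(5) p by (auto simp: hermitian_metric_def)
    show "codeg1_less
            (\<lambda>v. real (CARD('n) - 1) * exp (lam - F p) *
                  wedge (2 * (CARD('n) - 2)) 2
                    (wedge_pow (deform A chi \<phi> p) (CARD('n) - 2)) (\<omega> p) v)
            (\<lambda>v. real CARD('n) * wedge_pow (deform A chi \<phi> p) (CARD('n) - 1) v)"
    proof (rule codeg1_less_wedge_pow[OF assms(4) \<eta> \<omega> exp_gt_zero])
      show "ln (exp (lam - F p)) \<le> ln (top_quotient (wedge_pow (deform A chi \<phi> p) CARD('n))
          (wedge 2 (2 * (CARD('n) - 1)) (\<omega> p) (wedge_pow (deform A chi \<phi> p) (CARD('n) - 1))))"
        using assms(9) p unfolding Q_op_def by (auto simp: algebra_simps)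
    qed
  qed
  \<comment> \<open>The deformed metric itself witnesses the cone condition, since
    \<open>- (F p - lam)\<close> is the exponent \<open>lam - F p\<close> of the inequality just
    shown.\<close>
  have "deform A chi \<phi> \<in> ddbar_class A chi" using \<phi> by (auto simp: ddbar_class_def)
  moreover have "cone_inequality X \<omega> (\<lambda>p. F p - lam) (deform A chi \<phi>)"
    using main by (simp add: cone_inequality_def)
  ultimately show "ddbar_class A chi \<in> cone_C1 X \<omega> (\<lambda>p. F p - lam)"
    using pos unfolding cone_C1_def by blast
qed

end
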